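(* Let $\eta\in\mathbb{C}$, $N\in\mathbb{N}^*$, and let $R_{a,b}(\lambda)=\lambda I+\eta\mathbb{P}_{a,b}$ on $\mathbb{C}^2\otimes\mathbb{C}^2$ (the rational 6-vertex $R$-matrix, $\mathbb{P}$ the permutation). Let $K\in\operatorname{End}(\mathbb{C}^2)$ with $K\neq\alpha I$ for every $\alpha\in\mathbb{C}$, let $\xi_1,\dots,\xi_N\in\mathbb{C}$ satisfy $\xi_a\neq\xi_b+r\eta$ for all $a\neq b$ and $r\in\{-1,0,1\}$, and let $T^{(K)}(\lambda)=\operatorname{tr}_{V_a}\big(K_aR_{a,N}(\lambda-\xi_N)\cdots R_{a,1}(\lambda-\xi_1)\big)$ on $\mathcal{H}=(\mathbb{C}^2)^{\otimes N}$. Set $d(\lambda)=\prod_{a=1}^N(\lambda-\xi_a)$, $a(\lambda)=d(\lambda+\eta)$, $g_a(\lambda)=\prod_{b\neq a}\frac{\lambda-\xi_b}{\xi_a-\xi_b}$. Then the set of eigenvalues of $T^{(K)}(\lambda)$ is $$\Sigma_{T^{(K)}}=\Big\{t(\lambda)=\operatorname{tr}K\prod_{a=1}^N(\lambda-\xi_a)+\sum_{a=1}^Ng_a(\lambda)x_a\ :\ (x_1,\dots,x_N)\in\Sigma_T\Big\},$$ where $\Sigma_T$ is the set of solutions $(x_1,\dots,x_N)\in\mathbb{C}^N$ of the system $$x_n\Big[\operatorname{tr}K\prod_{a=1}^N(\xi_n-\xi_a-\eta)+\sum_{a=1}^Ng_a(\xi_n-\eta)x_a\Big]=a(\xi_n)d(\xi_n-\eta)\det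 K,\qquad n=1,\dots,N.$$ Moreover $T^{(K)}(\lambda)$ has $w$-simple spectrum, and for every $t(\lambda)\in\Sigma_{T^{(K)}}$ the associated unique eigenvector $|t\rangle$, normalized by $\langle S|t\rangle=1$, satisfies $$\langle h_1,\dots,h_N|t\rangle=\prod_{n=1}^N\Big(\frac{t(\xi_n)}{a(\xi_n)}\Big)^{h_n}$$ in the covector basis $\langle h_1,\dots,h_N|:=\langle S|\prod_{a=1}^N\big(T^{(K)}(\xi_a)/a(\xi_a)\big)^{h_a}$, $(h_1,\dots,h_N)\in\{0,1\}^N$, where $\langle S|\in\mathcal{H}^*$ is any covector for which this set is a basis of $\mathcal{H}^*$.
   Context: $w$-simple spectrum means each eigenvalue function $t(\lambda)$ of the commuting family has exactly one common eigenvector up to scalar. $\operatorname{tr}_{V_a}$ is the trace over the auxiliary space $V_a\cong\mathbb{C}^2$.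
   Formalization: The formal theorem assumes $\eta\neq 0$: for $\eta=0$ the transfer matrix is a scalar operator, so its spectrum is not $w$-simple, and $a(\xi_n)=0$ makes the covectors undefined. *)

theory Defs
  imports "HOL-Analysis.Analysis" "HOL-Library.FuncSet"
begin

text \<open>Sites are indexed 0..N-1 (paper: 1..N). Local spin basis of C^2 is indexed by the type 2.
  Basis states of H = (C^2)^{tensor N} are the extensional functions {..<N} -> 2.
  Vectors in H (and covectors in H^* ) are functions on these states (values off the
  state set are irrelevant).\<close>

definition states :: "nat \<Rightarrow> (nat \<Rightarrow> 2) set" where
  "states N = {..<N} \<rightarrow>\<^sub>E (UNIV :: 2 set)"

text \<open>Matrix entries of R(mu) = mu I + eta P on V_a (x) V_n:
  entry at row (a,b), column (a',b').\<close>
definition Rloc :: "complex \<Rightarrow> complex \<Rightarrow> 2 \<Rightarrow> 2 \<Rightarrow> 2 \<Rightarrow> 2 \<Rightarrow> complex" where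
  "Rloc \<eta> \<mu> a b a' b' =
     (if a = a' \<and> b = b' then \<mu> else 0) + (if a = b' \<and> b = a' then \<eta> else 0)"

text \<open>Matrix entry (row s, column s') of
  T^(K)(lambda) = tr_a (K_a R_{a,N}(lambda - xi_N) ... R_{a,1}(lambda - xi_1)).
  c is the auxiliary-space index chain: R for site n maps aux index c n to c (Suc n),
  K maps c N to c 0, and the trace closes the chain.\<close>
definition transfer ::
  "complex \<Rightarrow> (nat \<Rightarrow> complex) \<Rightarrow> complex^2^2 \<Rightarrow> nat \<Rightarrow> complex \<Rightarrow> (nat \<Rightarrow> 2) \<Rightarrow> (nat \<Rightarrow> 2) \<Rightarrow> complex"
  where
  "transfer \<eta> \<xi> K N z s s' =
     (\<Sum>c\<in>{..N} \<rightarrow>\<^sub>E (UNIV :: 2 set).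
        K $ (c 0) $ (c N) * (\<Prod>n<N. Rloc \<eta> (z - \<xi> n) (c (Suc n)) (s n) (c n) (s' n)))"

definition is_eigvec ::
  "complex \<Rightarrow> (nat \<Rightarrow> complex) \<Rightarrow> complex^2^2 \<Rightarrow> nat \<Rightarrow> (complex \<Rightarrow> complex) \<Rightarrow> ((nat \<Rightarrow> 2) \<Rightarrow> complex) \<Rightarrow> bool"
  where
  "is_eigvec \<eta> \<xi> K N t v \<longleftrightarrow>
     (\<exists>s\<in>states N. v s \<noteq> 0) \<and>
     (\<forall>z. \<forall>s\<in>states N. (\<Sum>s'\<in>states N. transfer \<eta> \<xi> K N z s s' * v s') = t z * v s)"

definition eigenvalues ::
  "complex \<Rightarrow> (nat \<Rightarrow> complex) \<Rightarrow> complex^2^2 \<Rightarrow> nat \<Rightarrow> (complex \<Rightarrow> complex) set" where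
  "eigenvalues \<eta> \<xi> K N = {t. \<exists>v. is_eigvec \<eta> \<xi> K N t v}"

definition w_simple :: "complex \<Rightarrow> (nat \<Rightarrow> complex) \<Rightarrow> complex^2^2 \<Rightarrow> nat \<Rightarrow> bool" where
  "w_simple \<eta> \<xi> K N \<longleftrightarrow>
     (\<forall>t\<in>eigenvalues \<eta> \<xi> K N. \<forall>v w. is_eigvec \<eta> \<xi> K N t v \<longrightarrow> is_eigvec \<eta> \<xi> K N t w \<longrightarrow>
        (\<exists>c::complex. \<forall>s\<in>states N. w s = c * v s))"

definition dfun :: "(nat \<Rightarrow> complex) \<Rightarrow> nat \<Rightarrow> complex \<Rightarrow> complex" where
  "dfun \<xi> N z = (\<Prod>a<N. z - \<xi> a)"

definition afun :: "complex \<Rightarrow> (nat \<Rightarrow> complex) \<Rightarrow> nat \<Rightarrow> complex \<Rightarrow> complex" where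
  "afun \<eta> \<xi> N z = dfun \<xi> N (z + \<eta>)"

definition gfun :: "(nat \<Rightarrow> complex) \<Rightarrow> nat \<Rightarrow> nat \<Rightarrow> complex \<Rightarrow> complex" where
  "gfun \<xi> N a z = (\<Prod>b\<in>{..<N} - {a}. (z - \<xi> b) / (\<xi> a - \<xi> b))"

definition covact :: "nat \<Rightarrow> ((nat \<Rightarrow> 2) \<Rightarrow> complex) \<Rightarrow> ((nat \<Rightarrow> 2) \<Rightarrow> (nat \<Rightarrow> 2) \<Rightarrow> complex) \<Rightarrow> ((nat \<Rightarrow> 2) \<Rightarrow> complex)"
  where "covact N u A = (\<lambda>s'. \<Sum>s\<in>states N. u s * A s s')"

definition pairing :: "nat \<Rightarrow> ((nat \<Rightarrow> 2) \<Rightarrow> complex) \<Rightarrow> ((nat \<Rightarrow> 2) \<Rightarrow> complex) \<Rightarrow> complex" where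
  "pairing N u v = (\<Sum>s\<in>states N. u s * v s)"

fun covec_aux ::
  "complex \<Rightarrow> (nat \<Rightarrow> complex) \<Rightarrow> complex^2^2 \<Rightarrow> nat \<Rightarrow> ((nat \<Rightarrow> 2) \<Rightarrow> complex) \<Rightarrow> (nat \<Rightarrow> nat) \<Rightarrow> nat \<Rightarrow> ((nat \<Rightarrow> 2) \<Rightarrow> complex)"
  where
  "covec_aux \<eta> \<xi> K N S h 0 = S"
| "covec_aux \<eta> \<xi> K N S h (Suc m) =
     ((\<lambda>u. covact N u (\<lambda>s s'. transfer \<eta> \<xi> K N (\<xi> m) s s' / afun \<eta> \<xi> N (\<xi> m))) ^^ h m)
       (covec_aux \<eta> \<xi> K N S h m)"

definition covec ::
  "complex \<Rightarrow> (nat \<Rightarrow> complex) \<Rightarrow> complex^2^2 \<Rightarrow> nat \<Rightarrow> ((nat \<Rightarrow> 2) \<Rightarrow> complex) \<Rightarrow> (nat \<Rightarrow> nat) \<Rightarrow> ((nat \<Rightarrow> 2) \<Rightarrow> complex)"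
  where "covec \<eta> \<xi> K N S h = covec_aux \<eta> \<xi> K N S h N"

definition hset :: "nat \<Rightarrow> (nat \<Rightarrow> nat) set" where
  "hset N = {..<N} \<rightarrow>\<^sub>E {0, 1}"

definition covector_basis :: "nat \<Rightarrow> ('i \<Rightarrow> (nat \<Rightarrow> 2) \<Rightarrow> complex) \<Rightarrow> 'i set \<Rightarrow> bool" where
  "covector_basis N F I \<longleftrightarrow>
     (\<forall>c. (\<forall>s\<in>states N. (\<Sum>h\<in>I. c h * F h s) = 0) \<longrightarrow> (\<forall>h\<in>I. c h = 0)) \<and>
     (\<forall>w. \<exists>c. \<forall>s\<in>states N. w s = (\<Sum>h\<in>I. c h * F h s))"

end

theory Submission
  imports Defs
begin

text \<open>
  The transfer matrices \<open>T(\<xi>\<^sub>a)\<close> commute by the Yang--Baxter exchange relation, and the quantum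
  determinant gives the fusion identity \<open>T(\<xi>\<^sub>n) T(\<xi>\<^sub>n - \<eta>) = a(\<xi>\<^sub>n) d(\<xi>\<^sub>n - \<eta>) det K\<close>. Since \<open>T\<close> is a
  polynomial of degree \<open>N\<close> with leading coefficient \<open>tr K\<close>, it is recovered by interpolation from its
  values at any \<open>N\<close> distinct points; interpolating at the \<open>\<xi>\<^sub>a\<close> and applying fusion to an
  eigenvector yields the system for \<open>x\<^sub>a = t(\<xi>\<^sub>a)\<close>.

  For the converse and for simplicity of the spectrum take a row vector \<open>x\<close> with \<open>x\<close> and \<open>y = x K\<close>
  independent, which exists because \<open>K\<close> is not scalar. The covector \<open>x \<otimes> \<dots> \<otimes> x\<close> is cyclic: applying
  \<open>T(\<xi>\<^sub>N), T(\<xi>\<^sub>N\<^sub>-\<^sub>1), \<dots>\<close> in this order, the operator \<open>T(\<xi>\<^sub>n)\<close> leaves the factors \<open>x\<close> at the sites below \<open>n\<close>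
  alone, and independence reduces site by site to the invertibility of a diagonal entry of the
  monodromy of the sites above \<open>n\<close>, which is triangular. A solution of the system prescribes the
  components of a vector in this covector basis; interpolating \<open>T\<close> at the points
  \<open>\<xi>\<^sub>a - h\<^sub>a \<eta>\<close>, adapted to each basis covector \<open>h\<close>, shows that it is an eigenvector.
\<close>

section \<open>Linear operators on wave functions\<close>

text \<open>Operators act on functions of an infinite chain of spins, of which the sites from \<open>N\<close> on are
  mere spectators; thus operators on different sets of sites live in one and the same ring.\<close>

type_synonym wave = "(nat \<Rightarrow> 2) \<Rightarrow> complex"

typedef chain_op = "{f :: wave \<Rightarrow> wave. \<forall>a u b v. f (\<lambda>s. a * u s + b * v s) = (\<lambda>s. a * f u s + b * f v s)}"
  morphisms app Abs_chain_op
  by (rule exI[of _ id]) simp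

setup_lifting type_definition_chain_op

notation app (infixr "\<rhd>" 70)

lemma chain_op_eqI: "(\<And>v s. (A \<rhd> v) s = (B \<rhd> v) s) \<Longrightarrow> A = B"
  by (metis app_inject ext)

instantiation chain_op :: ring_1
begin

lift_definition zero_chain_op :: chain_op is "\<lambda>v s. 0" by simp
lift_definition one_chain_op :: chain_op is "\<lambda>v. v" by simp
lift_definition plus_chain_op :: "chain_op \<Rightarrow> chain_op \<Rightarrow> chain_op" is "\<lambda>f g v s. f v s + g v s"
  by (simp add: algebra_simps)
lift_definition minus_chain_op :: "chain_op \<Rightarrow> chain_op \<Rightarrow> chain_op" is "\<lambda>f g v s. f v s - g v s"
  by (simp add: algebra_simps)
lift_definition uminus_chain_op :: "chain_op \<Rightarrow> chain_op" is "\<lambda>f v s. - f v s"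
  by (simp add: algebra_simps)
lift_definition times_chain_op :: "chain_op \<Rightarrow> chain_op \<Rightarrow> chain_op" is "\<lambda>f g v. f (g v)"
  by simp

lemma app_linear: "A \<rhd> (\<lambda>s. a * u s + b * v s) = (\<lambda>s. a * (A \<rhd> u) s + b * (A \<rhd> v) s)"
  using app[of A] by blast

lemma app_add: "A \<rhd> (\<lambda>s. u s + v s) = (\<lambda>s. (A \<rhd> u) s + (A \<rhd> v) s)"
  using app_linear[of A 1 u 1 v] by simp

lemma app_zero: "A \<rhd> (\<lambda>s. 0) = (\<lambda>s. 0)"
  using app_linear[of A 0 "\<lambda>s. 0" 0 "\<lambda>s. 0"] by simp

lemmas app_op = zero_chain_op.rep_eq one_chain_op.rep_eq plus_chain_op.rep_eq
  minus_chain_op.rep_eq uminus_chain_op.rep_eq times_chain_op.rep_eq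

instance
proof
  show "(0::chain_op) \<noteq> 1"
  proof
    assume "(0::chain_op) = 1"
    then have "((0::chain_op) \<rhd> (\<lambda>_. 1)) = ((1::chain_op) \<rhd> (\<lambda>_. 1))" by simp
    then show False by (simp add: app_op fun_eq_iff)
  qed
qed (auto intro!: chain_op_eqI simp: app_op app_add algebra_simps)

end

lift_definition cscale :: "complex \<Rightarrow> chain_op \<Rightarrow> chain_op" (infixr "\<odot>" 75)
  is "\<lambda>c f v s. c * f v s"
  by (simp add: algebra_simps)

lemma app_scale: "A \<rhd> (\<lambda>s. c * v s) = (\<lambda>s. c * (A \<rhd> v) s)"
  using app_linear[of A c v 0 v] by simp

lemma app_cscale: "(c \<odot> A) \<rhd> v = (\<lambda>s. c * (A \<rhd> v) s)"
  by (simp add: cscale.rep_eq)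

lemma cscale_times [simp]: "(c \<odot> A) * B = c \<odot> (A * B)"
  by (auto intro!: chain_op_eqI simp: app_op cscale.rep_eq)

lemma times_cscale [simp]: "A * (c \<odot> B) = c \<odot> (A * B)"
  by (auto intro!: chain_op_eqI simp: app_op cscale.rep_eq app_scale)

lemma cscale_cscale [simp]: "c \<odot> d \<odot> A = (c * d) \<odot> A"
  by (auto intro!: chain_op_eqI simp: app_op cscale.rep_eq)

lemma cscale_one [simp]: "1 \<odot> A = A"
  by (auto intro!: chain_op_eqI simp: app_op cscale.rep_eq)

lemma cscale_zero_left [simp]: "0 \<odot> A = 0"
  by (auto intro!: chain_op_eqI simp: app_op cscale.rep_eq)

lemma cscale_zero_right [simp]: "c \<odot> 0 = 0"
  by (auto intro!: chain_op_eqI simp: app_op cscale.rep_eq)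

lemma cscale_minus_left [simp]: "(- c) \<odot> A = - (c \<odot> A)"
  by (auto intro!: chain_op_eqI simp: app_op cscale.rep_eq)

lemma cscale_minus_right [simp]: "c \<odot> (- A) = - (c \<odot> A)"
  by (auto intro!: chain_op_eqI simp: app_op cscale.rep_eq)

lemma cscale_add_left: "(c + d) \<odot> A = c \<odot> A + d \<odot> A"
  by (auto intro!: chain_op_eqI simp: app_op cscale.rep_eq algebra_simps)

lemma cscale_add_right: "c \<odot> (A + B) = c \<odot> A + c \<odot> B"
  by (auto intro!: chain_op_eqI simp: app_op cscale.rep_eq algebra_simps)

lemma cscale_diff_left: "(c - d) \<odot> A = c \<odot> A - d \<odot> A"
  by (auto intro!: chain_op_eqI simp: app_op cscale.rep_eq algebra_simps)

lemma cscale_diff_right: "c \<odot> (A - B) = c \<odot> A - c \<odot> B"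
  by (auto intro!: chain_op_eqI simp: app_op cscale.rep_eq algebra_simps)

lemmas cscale_distribs = cscale_add_left cscale_add_right cscale_diff_left cscale_diff_right

lemma cscale_cancel: "c \<noteq> 0 \<Longrightarrow> c \<odot> A = c \<odot> B \<longleftrightarrow> A = B"
  by (metis cscale_cscale cscale_one field_class.field_inverse)

lemma cscale_sum_right: "c \<odot> (\<Sum>i\<in>I. A i) = (\<Sum>i\<in>I. c \<odot> A i)"
  by (induction I rule: infinite_finite_induct) (auto simp: cscale_add_right)

lemma cscale_sum_left: "(\<Sum>i\<in>I. c i) \<odot> A = (\<Sum>i\<in>I. c i \<odot> A)"
  by (induction I rule: infinite_finite_induct) (auto simp: cscale_add_left)

lemma app_sum_op: "((\<Sum>i\<in>I. A i) \<rhd> v) s = (\<Sum>i\<in>I. (A i \<rhd> v) s)"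
  by (induction I rule: infinite_finite_induct) (auto simp: app_op)

definition commutes :: "chain_op \<Rightarrow> chain_op \<Rightarrow> bool" where
  "commutes A B \<longleftrightarrow> A * B = B * A"

lemma commutes_sym: "commutes A B \<Longrightarrow> commutes B A"
  by (simp add: commutes_def)

lemma commutes_one [simp]: "commutes A 1"
  by (simp add: commutes_def)

lemma commutes_zero [simp]: "commutes A 0"
  by (simp add: commutes_def)

lemma commutes_add: "commutes A B \<Longrightarrow> commutes A C \<Longrightarrow> commutes A (B + C)"
  by (simp add: commutes_def algebra_simps)

lemma commutes_mult: "commutes A B \<Longrightarrow> commutes A C \<Longrightarrow> commutes A (B * C)"
  unfolding commutes_def by (metis mult.assoc)

lemma commutes_cscale: "commutes A B \<Longrightarrow> commutes A (c \<odot> B)"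
  by (simp add: commutes_def)

lemma commutes_sum: "(\<And>i. i \<in> I \<Longrightarrow> commutes A (B i)) \<Longrightarrow> commutes A (\<Sum>i\<in>I. B i)"
  by (simp add: commutes_def sum_distrib_left sum_distrib_right)

lemma commutes_inverse:
  assumes "commutes A B" "B * C = 1" "C * B = 1"
  shows "commutes A C"
proof -
  have "A * C = (C * B) * A * C" using assms by simp
  also have "\<dots> = C * (A * B) * C" using assms(1) by (simp add: commutes_def mult.assoc)
  also have "\<dots> = C * A" using assms by (simp add: mult.assoc)
  finally show ?thesis by (simp add: commutes_def)
qed

section \<open>Operators at a single site\<close>

lift_definition sub :: "nat \<Rightarrow> 2 \<Rightarrow> chain_op" is "\<lambda>n i v s. v (s(n := i))" by simp

lift_definition mul :: "nat \<Rightarrow> (2 \<Rightarrow> complex) \<Rightarrow> chain_op" is "\<lambda>n p v s. p (s n) * v s"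
  by (simp add: algebra_simps)

text \<open>Partial pairing of site \<open>n\<close> with the row vector \<open>w\<close>. The
  result is constant in spin \<open>n\<close>, so partial covectors are again elements of
  \<open>chain_op\<close>.\<close>

definition contr :: "nat \<Rightarrow> (2 \<Rightarrow> complex) \<Rightarrow> chain_op" where
  "contr n w = (\<Sum>i\<in>UNIV. w i \<odot> sub n i)"

text \<open>The matrix unit with its entry 1 in row \<open>a\<close> and column \<open>b\<close>,
  acting at site \<open>n\<close>.\<close>

definition munit :: "nat \<Rightarrow> 2 \<Rightarrow> 2 \<Rightarrow> chain_op" where
  "munit n a b = mul n (\<lambda>i. if i = a then 1 else 0) * sub n b"

lemma munit_mult: "munit n a b * munit n c d = (if b = c then munit n a d else 0)"
  by (rule chain_op_eqI) (auto simp: munit_def app_op sub.rep_eq mul.rep_eq)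

lemma munit_id: "munit n 1 1 + munit n 2 2 = 1"
proof (rule chain_op_eqI)
  fix v :: wave and s
  show "((munit n 1 1 + munit n 2 2) \<rhd> v) s = (1 \<rhd> v) s"
    using exhaust_2[of "s n"] by (auto simp: munit_def app_op sub.rep_eq mul.rep_eq fun_upd_idem)
qed

lemma commutes_sub_sub: "n \<noteq> m \<Longrightarrow> commutes (sub n i) (sub m j)"
  unfolding commutes_def by (rule chain_op_eqI) (simp add: app_op sub.rep_eq fun_upd_twist)

lemma commutes_sub_mul: "n \<noteq> m \<Longrightarrow> commutes (sub n i) (mul m p)"
  unfolding commutes_def by (rule chain_op_eqI) (simp add: app_op sub.rep_eq mul.rep_eq)

lemma commutes_mul_mul: "commutes (mul n p) (mul m q)"
  unfolding commutes_def by (rule chain_op_eqI) (simp add: app_op mul.rep_eq)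

lemma commutes_sub_munit: "n \<noteq> m \<Longrightarrow> commutes (sub n i) (munit m a b)"
  unfolding munit_def by (intro commutes_mult commutes_sub_mul commutes_sub_sub)

lemma commutes_mul_munit: "n \<noteq> m \<Longrightarrow> commutes (mul n p) (munit m a b)"
  unfolding munit_def by (intro commutes_mult commutes_mul_mul commutes_sym[OF commutes_sub_mul]) auto

lemma commutes_munit_munit: "n \<noteq> m \<Longrightarrow> commutes (munit n a b) (munit m c d)"
  unfolding munit_def[of n]
  by (intro commutes_sym[of _ "_ * _"] commutes_mult commutes_sym[OF commutes_mul_munit]
      commutes_sym[OF commutes_sub_munit])

lemma commutes_contr_munit: "n \<noteq> m \<Longrightarrow> commutes (contr n w) (munit m a b)"
  unfolding contr_def
  by (intro commutes_sym[of _ "sum _ _"] commutes_sum commutes_cscale commutes_sym[OF commutes_sub_munit])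

lemma contr_munit: "contr n w * munit n a b = w a \<odot> sub n b"
proof (rule chain_op_eqI)
  fix v :: wave and s
  show "((contr n w * munit n a b) \<rhd> v) s = ((w a \<odot> sub n b) \<rhd> v) s"
    using exhaust_2[of a]
    by (auto simp: contr_def munit_def app_op sub.rep_eq mul.rep_eq app_sum_op app_cscale sum_2)
qed

section \<open>Exchange relations of the monodromy\<close>

locale chain =
  fixes \<eta> :: complex and \<xi> :: "nat \<Rightarrow> complex"
begin

text \<open>Auxiliary entry \<open>(i, j)\<close> of the R-matrix at site \<open>m\<close>. The
  permutation pairs the auxiliary unit \<open>(i, j)\<close> with the unit \<open>(j, i)\<close> at
  the site, hence the reversed indices of \<open>munit\<close>.\<close>

definition lax :: "nat \<Rightarrow> complex \<Rightarrow> 2 \<Rightarrow> 2 \<Rightarrow> chain_op" where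
  "lax m z i j = (if i = j then (z - \<xi> m) \<odot> 1 else 0) + \<eta> \<odot> munit m j i"

text \<open>The list runs from the left factor to the right one; the full chain is
  \<open>rev [0..<N]\<close>, with site 0 as the rightmost factor.\<close>

fun mon :: "complex \<Rightarrow> nat list \<Rightarrow> 2 \<Rightarrow> 2 \<Rightarrow> chain_op" where
  "mon z [] i j = (if i = j then 1 else 0)"
| "mon z (m # ms) i j = (\<Sum>d\<in>UNIV. lax m z i d * mon z ms d j)"

text \<open>Components of \<open>R(\<nu>) A_1 B_2 = B_2 A_1 R(\<nu>)\<close> with two auxiliary
  spaces: the permutation swaps row indices on the left side and column indices on the right
  side.\<close>

definition rtt :: "complex \<Rightarrow> (2 \<Rightarrow> 2 \<Rightarrow> chain_op) \<Rightarrow> (2 \<Rightarrow> 2 \<Rightarrow> chain_op) \<Rightarrow> bool" where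
  "rtt \<nu> A B \<longleftrightarrow> (\<forall>i j k l. \<nu> \<odot> (A i j * B k l) + \<eta> \<odot> (A k j * B i l)
     = \<nu> \<odot> (B k l * A i j) + \<eta> \<odot> (B k j * A i l))"

lemma commutes_lax:
  "(\<And>a b. commutes A (munit m a b)) \<Longrightarrow> commutes A (lax m z i j)"
  by (auto simp: lax_def intro!: commutes_add commutes_cscale)

lemma commutes_mon:
  "(\<And>m a b. m \<in> set ms \<Longrightarrow> commutes A (munit m a b)) \<Longrightarrow> commutes A (mon z ms i j)"
  by (induction ms arbitrary: i) (auto intro!: commutes_sum commutes_mult commutes_lax)

lemma commutes_lax_mon: "m \<notin> set ms \<Longrightarrow> commutes (lax m z i j) (mon w ms k l)"
  by (intro commutes_mon commutes_sym[OF commutes_lax] commutes_munit_munit) auto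

lemma mon_append: "mon z (as @ bs) i j = (\<Sum>d\<in>UNIV. mon z as i d * mon z bs d j)"
proof (induction as arbitrary: i)
  case Nil
  show ?case using exhaust_2[of i] by (auto simp: sum_2)
next
  case (Cons m as)
  then show ?case by (simp add: sum_2 algebra_simps)
qed

text \<open>This is the Yang--Baxter equation, checked by multiplying matrix units.\<close>

lemma rtt_lax: "rtt (z - w) (lax m z) (lax m w)"
  unfolding rtt_def
  by (auto simp: lax_def munit_mult cscale_distribs algebra_simps)

text \<open>By the commutation of the middle factors the product regroups into pairs, and the
  R-matrix is carried first through the pair \<open>A, A'\<close> and then through
  \<open>B, B'\<close>.\<close>

lemma rtt_mult:
  assumes L: "rtt \<nu> A A'" and M: "rtt \<nu> B B'"
    and c: "\<And>i j k l. commutes (A i j) (B' k l)" "\<And>i j k l. commutes (A' i j) (B k l)"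
  shows "rtt \<nu> (\<lambda>i j. \<Sum>d\<in>UNIV. A i d * B d j) (\<lambda>i j. \<Sum>d\<in>UNIV. A' i d * B' d j)"
  unfolding rtt_def
proof (intro allI)
  fix i j k l :: 2
  have sw: "A i a * B a j * (A' k b * B' b l) = A i a * A' k b * (B a j * B' b l)"
    and sw': "A' i a * B' a j * (A k b * B b l) = A' i a * A k b * (B' a j * B b l)" for i a j k b l
    using c(2)[of k b a j] c(1)[of k b a j] by (simp_all add: commutes_def) (metis mult.assoc)+
  have "\<nu> \<odot> ((\<Sum>d\<in>UNIV. A i d * B d j) * (\<Sum>d\<in>UNIV. A' k d * B' d l))
      + \<eta> \<odot> ((\<Sum>d\<in>UNIV. A k d * B d j) * (\<Sum>d\<in>UNIV. A' i d * B' d l))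
    = (\<Sum>a\<in>UNIV. \<Sum>b\<in>UNIV. (\<nu> \<odot> (A i a * A' k b) + \<eta> \<odot> (A k a * A' i b)) * (B a j * B' b l))"
    unfolding sum_product sw by (simp add: cscale_sum_right sum.distrib distrib_right)
  also have "\<dots> = (\<Sum>a\<in>UNIV. \<Sum>b\<in>UNIV. (\<nu> \<odot> (A' k b * A i a) + \<eta> \<odot> (A' k a * A i b)) * (B a j * B' b l))"
    using L unfolding rtt_def by simp
  \<comment> \<open>The summation indices \<open>a\<close> and \<open>b\<close> are exchanged in the
    \<eta> term.\<close>
  also have "\<dots> = (\<Sum>a\<in>UNIV. \<Sum>b\<in>UNIV. A' k b * A i a * (\<nu> \<odot> (B a j * B' b l) + \<eta> \<odot> (B b j * B' a l)))"
    by (simp add: sum_2 algebra_simps)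
  also have "\<dots> = (\<Sum>a\<in>UNIV. \<Sum>b\<in>UNIV. A' k b * A i a * (\<nu> \<odot> (B' b l * B a j) + \<eta> \<odot> (B' b j * B a l)))"
    using M unfolding rtt_def by simp
  also have "\<dots> = \<nu> \<odot> ((\<Sum>d\<in>UNIV. A' k d * B' d l) * (\<Sum>d\<in>UNIV. A i d * B d j))
      + \<eta> \<odot> ((\<Sum>d\<in>UNIV. A' k d * B' d j) * (\<Sum>d\<in>UNIV. A i d * B d l))"
    unfolding sum_product sw' by (simp add: sum_2 cscale_add_right algebra_simps)
  finally show "\<nu> \<odot> ((\<Sum>d\<in>UNIV. A i d * B d j) * (\<Sum>d\<in>UNIV. A' k d * B' d l))
      + \<eta> \<odot> ((\<Sum>d\<in>UNIV. A k d * B d j) * (\<Sum>d\<in>UNIV. A' i d * B' d l))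
    = \<nu> \<odot> ((\<Sum>d\<in>UNIV. A' k d * B' d l) * (\<Sum>d\<in>UNIV. A i d * B d j))
      + \<eta> \<odot> ((\<Sum>d\<in>UNIV. A' k d * B' d j) * (\<Sum>d\<in>UNIV. A i d * B d l))" .
qed

lemma rtt_mon: "distinct ms \<Longrightarrow> rtt (z - w) (mon z ms) (mon w ms)"
proof (induction ms)
  case Nil
  show ?case by (auto simp: rtt_def)
next
  case (Cons m ms)
  then have "rtt (z - w) (\<lambda>i j. \<Sum>d\<in>UNIV. lax m z i d * mon z ms d j)
    (\<lambda>i j. \<Sum>d\<in>UNIV. lax m w i d * mon w ms d j)"
    by (intro rtt_mult rtt_lax commutes_lax_mon) auto
  moreover have "mon z (m # ms) = (\<lambda>i j. \<Sum>d\<in>UNIV. lax m z i d * mon z ms d j)" for z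
    by (intro ext) simp
  ultimately show ?case by simp
qed

text \<open>Contracting the exchange relation with the twist in the two possible ways gives
  \<open>\<nu> C = - \<eta> Q\<close> and \<open>\<nu> Q = - \<eta> C\<close> for the commutator \<open>C\<close> of the traces.\<close>

lemma rtt_imp_commutes_trace:
  assumes rtt: "rtt \<nu> A B" and \<nu>: "\<nu>\<^sup>2 \<noteq> \<eta>\<^sup>2"
  shows "commutes (\<Sum>i\<in>UNIV. \<Sum>j\<in>UNIV. K j i \<odot> A i j) (\<Sum>i\<in>UNIV. \<Sum>j\<in>UNIV. K j i \<odot> B i j)"
proof -
  define tot :: "(2 \<Rightarrow> 2 \<Rightarrow> 2 \<Rightarrow> 2 \<Rightarrow> chain_op) \<Rightarrow> chain_op" where
    "tot F = (\<Sum>i\<in>UNIV. \<Sum>j\<in>UNIV. \<Sum>k\<in>UNIV. \<Sum>l\<in>UNIV. F i j k l)" for F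
  have swap_jl: "tot F = tot (\<lambda>i j k l. F i l k j)" for F
    by (simp add: tot_def sum_2 add_ac)
  have swap_ik: "tot F = tot (\<lambda>i j k l. F k j i l)" for F
    by (simp add: tot_def sum_2 add_ac)
  have tot_diff: "tot (\<lambda>i j k l. F i j k l - G i j k l) = tot F - tot G" for F G
    by (simp add: tot_def sum_subtractf)
  have tot_scale: "tot (\<lambda>i j k l. c \<odot> F i j k l) = c \<odot> tot F" for F c
    by (simp add: tot_def cscale_sum_right)
  \<comment> \<open>\<open>C\<close> is the commutator of the traces. In \<open>Q\<close> the twist
    joins the column of each factor to the row of the other factor.\<close>
  define C where "C = tot (\<lambda>i j k l. (K j i * K l k) \<odot> (A i j * B k l))
    - tot (\<lambda>i j k l. (K j i * K l k) \<odot> (B k l * A i j))"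
  define Q where "Q = tot (\<lambda>i j k l. (K j k * K l i) \<odot> (A i j * B k l))
    - tot (\<lambda>i j k l. (K j k * K l i) \<odot> (B k l * A i j))"
  have eq: "\<nu> \<odot> (A i j * B k l) - \<nu> \<odot> (B k l * A i j) = \<eta> \<odot> (B k j * A i l) - \<eta> \<odot> (A k j * B i l)"
    for i j k l
    using rtt unfolding rtt_def by (simp add: algebra_simps)
  have sc: "\<nu> \<odot> (tot (\<lambda>i j k l. c i j k l \<odot> (A i j * B k l)) - tot (\<lambda>i j k l. c i j k l \<odot> (B k l * A i j)))
    = \<eta> \<odot> (tot (\<lambda>i j k l. c i j k l \<odot> (B k j * A i l)) - tot (\<lambda>i j k l. c i j k l \<odot> (A k j * B i l)))" for c
  proof -
    have "\<nu> \<odot> (tot (\<lambda>i j k l. c i j k l \<odot> (A i j * B k l)) - tot (\<lambda>i j k l. c i j k l \<odot> (B k l * A i j)))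
      = tot (\<lambda>i j k l. c i j k l \<odot> (\<nu> \<odot> (A i j * B k l) - \<nu> \<odot> (B k l * A i j)))"
      by (simp add: cscale_diff_right tot_diff mult.commute[of _ \<nu>] flip: tot_scale)
    also have "\<dots> = \<eta> \<odot> (tot (\<lambda>i j k l. c i j k l \<odot> (B k j * A i l)) - tot (\<lambda>i j k l. c i j k l \<odot> (A k j * B i l)))"
      unfolding eq by (simp add: cscale_diff_right tot_diff mult.commute[of _ \<eta>] flip: tot_scale)
    finally show ?thesis .
  qed
  \<comment> \<open>Exchanging \<open>j\<close> with \<open>l\<close> in one term and
    \<open>i\<close> with \<open>k\<close> in the other turns the weights of \<open>C\<close> into
    those of \<open>Q\<close>; the same exchange leads back from \<open>Q\<close> to
    \<open>C\<close>.\<close>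
  have 1: "\<nu> \<odot> C = - (\<eta> \<odot> Q)"
    unfolding C_def Q_def sc
    by (subst swap_jl, subst (2) swap_ik) (simp add: cscale_diff_right mult.commute)
  have 2: "\<nu> \<odot> Q = - (\<eta> \<odot> C)"
    unfolding C_def Q_def sc
    by (subst swap_jl, subst (2) swap_ik) (simp add: cscale_diff_right mult.commute)
  have "(\<nu>\<^sup>2) \<odot> C = \<nu> \<odot> (\<nu> \<odot> C)" by (simp add: power2_eq_square)
  also have "\<dots> = - (\<eta> \<odot> (\<nu> \<odot> Q))" unfolding 1 by (simp add: mult.commute)
  also have "\<dots> = (\<eta>\<^sup>2) \<odot> C" unfolding 2 by (simp add: power2_eq_square)
  finally have "(\<nu>\<^sup>2 - \<eta>\<^sup>2) \<odot> C = (\<nu>\<^sup>2 - \<eta>\<^sup>2) \<odot> 0" by (simp add: cscale_diff_left)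
  then have "C = 0" using \<nu> by (subst (asm) cscale_cancel) auto
  moreover have "(\<Sum>i\<in>UNIV. \<Sum>j\<in>UNIV. K j i \<odot> A i j) * (\<Sum>i\<in>UNIV. \<Sum>j\<in>UNIV. K j i \<odot> B i j)
    = tot (\<lambda>i j k l. (K j i * K l k) \<odot> (A i j * B k l))"
    unfolding tot_def by (simp add: sum_2 cscale_add_right distrib_left distrib_right mult.commute add_ac)
  moreover have "(\<Sum>i\<in>UNIV. \<Sum>j\<in>UNIV. K j i \<odot> B i j) * (\<Sum>i\<in>UNIV. \<Sum>j\<in>UNIV. K j i \<odot> A i j)
    = tot (\<lambda>i j k l. (K j i * K l k) \<odot> (B k l * A i j))"
    unfolding tot_def by (simp add: sum_2 cscale_add_right distrib_left distrib_right mult.commute add_ac)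
  ultimately show ?thesis
    unfolding commutes_def C_def by simp
qed

text \<open>At \<nu> = \<eta> the R-matrix is \<open>\<eta> (1 + P)\<close>, a multiple of the
  symmetrizer.\<close>

lemma rtt_imp_symmetric:
  assumes "rtt \<eta> A B" "\<eta> \<noteq> 0"
  shows "A i j * B k l + A k j * B i l = B k l * A i j + B k j * A i l"
proof -
  have "\<eta> \<odot> (A i j * B k l + A k j * B i l) = \<eta> \<odot> (B k l * A i j + B k j * A i l)"
    using assms(1) by (simp add: rtt_def cscale_add_right)
  then show ?thesis using assms(2) by (simp add: cscale_cancel)
qed

end

section \<open>Fusion\<close>

context chain
begin

text \<open>The relation \<open>(1 + P) A_1 B_2 = 0\<close>: the product maps into the antisymmetric
  part of the two auxiliary spaces.\<close>

definition anti :: "(2 \<Rightarrow> 2 \<Rightarrow> chain_op) \<Rightarrow> (2 \<Rightarrow> 2 \<Rightarrow> chain_op) \<Rightarrow> bool" where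
  "anti A B \<longleftrightarrow> (\<forall>i j k l. A i j * B k l + A k j * B i l = 0)"

lemma commuting_product_swap:
  assumes "\<And>i j k l. commutes (A' i j) (B k l)"
  shows "(\<Sum>d\<in>UNIV. A i d * B d j) * (\<Sum>d\<in>UNIV. A' k d * B' d l)
    = (\<Sum>a\<in>UNIV. \<Sum>b\<in>UNIV. A i a * A' k b * (B a j * B' b l))"
proof -
  have "A i a * B a j * (A' k b * B' b l) = A i a * A' k b * (B a j * B' b l)" for a b
    using assms[of k b a j] by (simp add: commutes_def) (metis mult.assoc)
  then show ?thesis unfolding sum_product by simp
qed

text \<open>The row indices \<open>i\<close> and \<open>k\<close> occur only in the left pair, so
  its antisymmetry passes to the product.\<close>

lemma anti_mult_left:
  assumes "anti A A'" "\<And>i j k l. commutes (A' i j) (B k l)"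
  shows "anti (\<lambda>i j. \<Sum>d\<in>UNIV. A i d * B d j) (\<lambda>i j. \<Sum>d\<in>UNIV. A' i d * B' d j)"
  using assms(1)
  unfolding anti_def commuting_product_swap[of A' B, OF assms(2), where A = A and B' = B']
  by (simp flip: sum.distrib distrib_right)

text \<open>The symmetrizer passes through the left pair, reversing its order, and then annihilates
  the right pair.\<close>

lemma anti_mult_right:
  assumes "rtt \<eta> A A'" "\<eta> \<noteq> 0" "anti B B'" "\<And>i j k l. commutes (A' i j) (B k l)"
  shows "anti (\<lambda>i j. \<Sum>d\<in>UNIV. A i d * B d j) (\<lambda>i j. \<Sum>d\<in>UNIV. A' i d * B' d j)"
  unfolding anti_def commuting_product_swap[of A' B, OF assms(4), where A = A and B' = B']
proof (intro allI)
  fix i j k l :: 2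
  have "(\<Sum>a\<in>UNIV. \<Sum>b\<in>UNIV. A i a * A' k b * (B a j * B' b l))
      + (\<Sum>a\<in>UNIV. \<Sum>b\<in>UNIV. A k a * A' i b * (B a j * B' b l))
    = (\<Sum>a\<in>UNIV. \<Sum>b\<in>UNIV. (A i a * A' k b + A k a * A' i b) * (B a j * B' b l))"
    by (simp add: sum.distrib distrib_right)
  also have "\<dots> = (\<Sum>a\<in>UNIV. \<Sum>b\<in>UNIV. (A' k b * A i a + A' k a * A i b) * (B a j * B' b l))"
    using rtt_imp_symmetric[OF assms(1,2)] by simp
  also have "\<dots> = (\<Sum>a\<in>UNIV. \<Sum>b\<in>UNIV. A' k b * A i a * (B a j * B' b l + B b j * B' a l))"
    by (simp add: sum_2 distrib_left distrib_right add_ac)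
  also have "\<dots> = 0"
    using assms(3) by (simp add: anti_def)
  finally show "(\<Sum>a\<in>UNIV. \<Sum>b\<in>UNIV. A i a * A' k b * (B a j * B' b l))
      + (\<Sum>a\<in>UNIV. \<Sum>b\<in>UNIV. A k a * A' i b * (B a j * B' b l)) = 0" .
qed

text \<open>The two matrices are \<open>\<eta> P_{1m}\<close> and
  \<open>\<eta> (P_{2m} - 1)\<close>, and \<open>P_{1m} (P_{2m} - 1) = (P_{12} - 1) P_{1m}\<close>
  is killed by \<open>1 + P_{12}\<close>.\<close>

lemma anti_lax: "anti (lax m (\<xi> m)) (lax m (\<xi> m - \<eta>))"
  unfolding anti_def
  by (auto simp: lax_def munit_mult cscale_distribs algebra_simps)

text \<open>Site \<open>m\<close> creates the antisymmetry. It survives the factors to the right of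
  \<open>m\<close> by \<open>anti_mult_left\<close> and those to the left by
  \<open>anti_mult_right\<close>.\<close>

lemma anti_mon:
  assumes "distinct ms" "m \<in> set ms" "\<eta> \<noteq> 0"
  shows "anti (mon (\<xi> m) ms) (mon (\<xi> m - \<eta>) ms)"
  using assms(1,2)
proof (induction ms)
  case Nil
  then show ?case by simp
next
  case (Cons n ms)
  have mon_eq: "mon z (n # ms) = (\<lambda>i j. \<Sum>d\<in>UNIV. lax n z i d * mon z ms d j)" for z
    by (intro ext) simp
  have com: "commutes (lax n w i j) (mon z ms k l)" for w z i j k l
    using Cons.prems by (intro commutes_lax_mon) simp
  show ?case
  proof (cases "n = m")
    case True
    then show ?thesis unfolding mon_eq by (intro anti_mult_left com) (simp add: anti_lax)
  next
    case False
    then have "anti (mon (\<xi> m) ms) (mon (\<xi> m - \<eta>) ms)" using Cons by simp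
    moreover have "rtt \<eta> (lax n (\<xi> m)) (lax n (\<xi> m - \<eta>))"
      using rtt_lax[of "\<xi> m" "\<xi> m - \<eta>" n] by simp
    ultimately show ?thesis unfolding mon_eq using assms(3) by (intro anti_mult_right com)
  qed
qed

section \<open>Quantum determinant and fusion of traces\<close>

definition eps :: "2 \<Rightarrow> 2 \<Rightarrow> complex" where
  "eps i k = (if i = k then 0 else if i = 1 then 1 else - 1)"

lemma eps_simps [simp]: "eps i i = 0" "eps 1 2 = 1" "eps 2 1 = - 1"
  by (auto simp: eps_def)

lemma lax_qdet:
  "lax m z i 1 * lax m (z - \<eta>) k 2 - lax m z i 2 * lax m (z - \<eta>) k 1
    = (eps i k * ((z + \<eta> - \<xi> m) * (z - \<eta> - \<xi> m))) \<odot> 1"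
proof -
  have one: "1 = munit m 1 1 + munit m 2 2" by (simp add: munit_id)
  define \<mu> where "\<mu> = z - \<xi> m"
  have z: "z = \<mu> + \<xi> m" by (simp add: \<mu>_def)
  show ?thesis
    unfolding z using exhaust_2[of i] exhaust_2[of k]
    by (auto simp: lax_def munit_mult cscale_distribs algebra_simps)
       (simp_all add: one cscale_distribs munit_mult algebra_simps)
qed

text \<open>Antisymmetrizing the columns of the right factors yields a scalar times
  \<open>eps a b\<close>, so the left factors enter only through their own column
  antisymmetrization: quantum determinants multiply along the chain.\<close>

lemma mon_qdet:
  "distinct ms \<Longrightarrow>
    mon z ms i 1 * mon (z - \<eta>) ms k 2 - mon z ms i 2 * mon (z - \<eta>) ms k 1
    = (eps i k * (\<Prod>m\<in>set ms. (z + \<eta> - \<xi> m) * (z - \<eta> - \<xi> m))) \<odot> 1"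
proof (induction ms arbitrary: i k)
  case Nil
  show ?case using exhaust_2[of i] exhaust_2[of k] by auto
next
  case (Cons m ms)
  let ?L = "lax m z" and ?L' = "lax m (z - \<eta>)" and ?M = "mon z ms" and ?M' = "mon (z - \<eta>) ms"
  let ?c = "\<Prod>m\<in>set ms. (z + \<eta> - \<xi> m) * (z - \<eta> - \<xi> m)"
  have com: "commutes (lax m w i j) (mon z ms k l)" for w z i j k l
    using Cons.prems by (intro commutes_lax_mon) simp
  have "mon z (m # ms) i 1 * mon (z - \<eta>) (m # ms) k 2 - mon z (m # ms) i 2 * mon (z - \<eta>) (m # ms) k 1
    = (\<Sum>a\<in>UNIV. \<Sum>b\<in>UNIV. ?L i a * ?L' k b * (?M a 1 * ?M' b 2 - ?M a 2 * ?M' b 1))"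
    unfolding mon.simps commuting_product_swap[of ?L' ?M, OF com, where A = ?L and B' = ?M']
    by (simp add: sum_subtractf right_diff_distrib)
  also have "\<dots> = ?c \<odot> (?L i 1 * ?L' k 2 - ?L i 2 * ?L' k 1)"
    using Cons by (simp add: sum_2 cscale_diff_right)
  finally show ?case
    using Cons.prems by (simp add: lax_qdet mult_ac)
qed

lemma add_self_eq_0: "A + A = 0 \<Longrightarrow> A = (0 :: chain_op)"
proof -
  assume "A + A = 0"
  then have "2 \<odot> A = 2 \<odot> 0"
    using cscale_add_left[of 1 1 A] by simp
  then show ?thesis by (subst (asm) cscale_cancel) auto
qed

text \<open>Antisymmetry kills products with equal row indices and makes those with rows 1, 2 and 2,
  1 opposite; the weights of \<open>K\<close> then combine to its determinant times the quantum
  determinant.\<close>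

lemma trace_fusion:
  assumes "anti A B" and qdet: "\<And>i k. A i 1 * B k 2 - A i 2 * B k 1 = (eps i k * c) \<odot> 1"
  shows "(\<Sum>i\<in>UNIV. \<Sum>j\<in>UNIV. K j i \<odot> A i j) * (\<Sum>i\<in>UNIV. \<Sum>j\<in>UNIV. K j i \<odot> B i j)
    = (c * (K 1 1 * K 2 2 - K 1 2 * K 2 1)) \<odot> 1"
proof -
  have diag: "A i j * B i l = 0" for i j l
    using assms(1) unfolding anti_def by (metis add_self_eq_0)
  have off: "A 2 j * B 1 l = - (A 1 j * B 2 l)" for j l
    using assms(1) unfolding anti_def by (metis add_eq_0_iff2 add.commute)
  have "(\<Sum>i\<in>UNIV. \<Sum>j\<in>UNIV. K j i \<odot> A i j) * (\<Sum>i\<in>UNIV. \<Sum>j\<in>UNIV. K j i \<odot> B i j)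
    = (K 1 1 * K 2 2 - K 1 2 * K 2 1) \<odot> (A 1 1 * B 2 2 - A 1 2 * B 2 1)"
    by (simp add: sum_2 distrib_left distrib_right diag off cscale_distribs mult.commute add_ac)
  then show ?thesis by (simp add: qdet mult_ac)
qed

end

section \<open>Invertibility of a corner of the monodromy\<close>

definition rank_one :: "nat \<Rightarrow> (2 \<Rightarrow> complex) \<Rightarrow> (2 \<Rightarrow> complex) \<Rightarrow> chain_op" where
  "rank_one m a b = (\<Sum>d\<in>UNIV. \<Sum>l\<in>UNIV. (a d * b l) \<odot> munit m d l)"

lemma rank_one_mult: "rank_one m a b * rank_one m a' b' = (\<Sum>i\<in>UNIV. b i * a' i) \<odot> rank_one m a b'"
  by (simp add: rank_one_def sum_2 distrib_left distrib_right munit_mult cscale_distribs algebra_simps)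

text \<open>Contracting the auxiliary space of the permutation with a row \<open>b\<close> and a
  column \<open>a\<close> leaves the column-row product of \<open>a\<close> and \<open>b\<close> at
  the site.\<close>

lemma (in chain) lax_contract:
  "(\<Sum>l\<in>UNIV. \<Sum>d\<in>UNIV. (b l * a d) \<odot> lax m z l d)
    = ((\<Sum>i\<in>UNIV. b i * a i) * (z - \<xi> m)) \<odot> 1 + \<eta> \<odot> rank_one m a b"
  by (simp add: rank_one_def lax_def sum_2 cscale_distribs algebra_simps)

lemma idempotent_resolution:
  assumes "\<pi> * \<pi> = \<pi>" "a * b = 1" "c * d = 1"
  shows "(a \<odot> (1 - \<pi>) + c \<odot> \<pi>) * (b \<odot> (1 - \<pi>) + d \<odot> \<pi>) = 1"
proof -
  have "b * a = 1" "d * c = 1" using assms(2,3) by (simp_all add: mult.commute)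
  then show ?thesis
    using assms by (simp add: distrib_left distrib_right right_diff_distrib left_diff_distrib)
qed

text \<open>The sum equals \<open>\<alpha> * D * (1 + n)\<close> with
  \<open>n = D' * \<alpha>' * \<rho> * C\<close>. Commuting factors produces
  \<open>\<rho> * \<alpha>' * \<rho>\<close> inside \<open>n * n\<close>, so
  \<open>n * n = 0\<close> and \<open>1 - n\<close> inverts \<open>1 + n\<close>.\<close>

lemma triangular_inverse:
  fixes \<alpha> :: "'a :: ring_1"
  assumes \<alpha>: "\<alpha> * \<alpha>' = 1" "\<alpha>' * \<alpha> = 1" and D: "D * D' = 1" "D' * D = 1"
    and nil: "\<rho> * \<alpha>' * \<rho> = 0"
    and com: "\<alpha>' * D' = D' * \<alpha>'" "\<rho> * D' = D' * \<rho>" "C * \<alpha>' = \<alpha>' * C" "C * \<rho> = \<rho> * C"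
  obtains W where "(\<alpha> * D + \<rho> * C) * W = 1" "W * (\<alpha> * D + \<rho> * C) = 1"
proof -
  define n where "n = D' * \<alpha>' * \<rho> * C"
  have aD: "\<alpha> * D * (D' * \<alpha>') = 1" "D' * \<alpha>' * (\<alpha> * D) = 1"
    using \<alpha> D by (metis mult.assoc mult_1_right)+
  have "C * D' * \<alpha>' * \<rho> = \<alpha>' * \<rho> * (C * D')"
    using com by (metis mult.assoc)
  moreover have "n * n = D' * \<alpha>' * \<rho> * (C * D' * \<alpha>' * \<rho>) * C"
    by (simp add: n_def mult.assoc)
  ultimately have "n * n = D' * \<alpha>' * (\<rho> * \<alpha>' * \<rho>) * (C * D') * C"
    by (simp only: mult.assoc)
  then have nn: "n * n = 0" using nil by simp
  have eq: "\<alpha> * D + \<rho> * C = \<alpha> * D * (1 + n)"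
    using aD(1) by (simp add: n_def distrib_left) (metis mult.assoc mult_1_left)
  have "(1 + n) * (1 - n) = 1" "(1 - n) * (1 + n) = 1"
    using nn by (simp_all add: algebra_simps)
  then have "\<alpha> * D * (1 + n) * ((1 - n) * (D' * \<alpha>')) = 1" "(1 - n) * (D' * \<alpha>') * (\<alpha> * D * (1 + n)) = 1"
    using aD by (metis mult.assoc mult_1_right)+
  then show ?thesis using that unfolding eq by blast
qed

text \<open>The columns \<open>p, q\<close> form the basis dual to the rows \<open>x, y\<close>;
  \<open>dual\<close> and \<open>resolution\<close> are the two products of the mutually inverse
  matrices.\<close>

locale framed_chain = chain +
  fixes x y p q :: "2 \<Rightarrow> complex"
  assumes dual: "(\<Sum>i\<in>UNIV. x i * p i) = 1" "(\<Sum>i\<in>UNIV. x i * q i) = 0"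
      "(\<Sum>i\<in>UNIV. y i * p i) = 0" "(\<Sum>i\<in>UNIV. y i * q i) = 1"
    and resolution: "p i * x j + q i * y j = (if i = j then 1 else 0)"
begin

text \<open>In the basis of the first site dual to \<open>x, y\<close>, the corner is block triangular with diagonal
  blocks \<open>(z - \<xi>) D\<close> and \<open>(z - \<xi> + \<eta>) D\<close>, where \<open>D\<close> is the corner of the remaining sites.\<close>

lemma corner_invertible:
  assumes "distinct ms" "\<And>m. m \<in> set ms \<Longrightarrow> z \<noteq> \<xi> m \<and> z \<noteq> \<xi> m - \<eta>"
  shows "\<exists>W. (\<Sum>l\<in>UNIV. \<Sum>i\<in>UNIV. (y l * q i) \<odot> mon z ms l i) * W = 1 \<and>
    W * (\<Sum>l\<in>UNIV. \<Sum>i\<in>UNIV. (y l * q i) \<odot> mon z ms l i) = 1"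
  using assms
proof (induction ms)
  case Nil
  show ?case using dual(4) by (intro exI[of _ 1]) (simp add: sum_2 flip: cscale_add_left)
next
  case (Cons m ms)
  \<comment> \<open>\<open>C\<close> and \<open>D\<close> are the \<open>x\<close> and
    \<open>y\<close> components of the column \<open>c\<close> of the remaining sites.\<close>
  define c where "c d = (\<Sum>i\<in>UNIV. q i \<odot> mon z ms d i)" for d
  define D where "D = (\<Sum>l\<in>UNIV. y l \<odot> c l)"
  define C where "C = (\<Sum>l\<in>UNIV. x l \<odot> c l)"
  define \<pi> where "\<pi> = rank_one m q y"
  define \<rho> where "\<rho> = rank_one m p y"
  define \<alpha> where "\<alpha> = (z - \<xi> m) \<odot> 1 + \<eta> \<odot> \<pi>"
  define \<alpha>' where "\<alpha>' = (1 / (z - \<xi> m)) \<odot> (1 - \<pi>) + (1 / (z - \<xi> m + \<eta>)) \<odot> \<pi>"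
  have nz: "z - \<xi> m \<noteq> 0" "z - \<xi> m + \<eta> \<noteq> 0"
    using Cons.prems(2)[of m] by (auto simp: algebra_simps eq_diff_eq)
  have D_eq: "(\<Sum>l\<in>UNIV. \<Sum>i\<in>UNIV. (y l * q i) \<odot> mon z ms l i) = D"
    by (simp add: D_def c_def cscale_sum_right)
  have "distinct ms" "\<And>m. m \<in> set ms \<Longrightarrow> z \<noteq> \<xi> m \<and> z \<noteq> \<xi> m - \<eta>"
    using Cons.prems by auto
  from Cons.IH[OF this] obtain D' where D': "D * D' = 1" "D' * D = 1"
    unfolding D_eq by blast
  have rel: "\<pi> * \<pi> = \<pi>" "\<rho> * \<pi> = \<rho>" "\<rho> * \<rho> = 0"
    using dual by (simp_all add: \<pi>_def \<rho>_def rank_one_mult)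
  have \<alpha>_eq: "\<alpha> = (z - \<xi> m) \<odot> (1 - \<pi>) + (z - \<xi> m + \<eta>) \<odot> \<pi>"
    by (simp add: \<alpha>_def cscale_distribs)
  have \<alpha>: "\<alpha> * \<alpha>' = 1" "\<alpha>' * \<alpha> = 1"
    unfolding \<alpha>_eq \<alpha>'_def using nz by (intro idempotent_resolution rel(1); simp)+
  \<comment> \<open>\<open>\<rho> * \<alpha>'\<close> is a multiple of \<rho>, and \<rho> squares to
    zero because \<open>y\<close> annihilates \<open>p\<close>.\<close>
  have nil: "\<rho> * \<alpha>' * \<rho> = 0"
    using rel by (simp add: \<alpha>'_def distrib_left distrib_right right_diff_distrib left_diff_distrib)
  have com_mon: "commutes (rank_one m a b) (mon z ms i j)" for a b i j
    unfolding rank_one_def using Cons.prems(1)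
    by (intro commutes_mon commutes_sym[of _ "sum _ _"] commutes_sum commutes_cscale commutes_munit_munit) auto
  have com: "commutes (rank_one m a b) D" "commutes (rank_one m a b) C" for a b
    unfolding D_def C_def c_def by (intro commutes_sum commutes_cscale com_mon)+
  have com': "commutes (rank_one m a b) D'" for a b
    by (rule commutes_inverse[OF com(1) D'])
  have \<alpha>'_eq: "\<alpha>' = (1 / (z - \<xi> m)) \<odot> 1 + (1 / (z - \<xi> m + \<eta>) - 1 / (z - \<xi> m)) \<odot> \<pi>"
    by (simp add: \<alpha>'_def cscale_distribs)
  have com_\<alpha>: "commutes D' \<alpha>'" "commutes C \<alpha>'"
    unfolding \<alpha>'_eq \<pi>_def by (intro commutes_add commutes_cscale commutes_one commutes_sym[OF com'] commutes_sym[OF com(2)])+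
  obtain W where W: "(\<alpha> * D + \<rho> * (\<eta> \<odot> C)) * W = 1" "W * (\<alpha> * D + \<rho> * (\<eta> \<odot> C)) = 1"
    using triangular_inverse[OF \<alpha> D' nil, of "\<eta> \<odot> C"] com_\<alpha> com com'
    unfolding commutes_def \<rho>_def by (metis cscale_times times_cscale)
  \<comment> \<open>The frame resolves the auxiliary index between site \<open>m\<close> and the
    remaining sites.\<close>
  have c_split: "c d = p d \<odot> C + q d \<odot> D" for d
  proof -
    have "p d \<odot> C + q d \<odot> D = (p d * x 1 + q d * y 1) \<odot> c 1 + (p d * x 2 + q d * y 2) \<odot> c 2"
      by (simp add: C_def D_def sum_2 cscale_distribs add_ac)
    then show ?thesis using exhaust_2[of d] by (auto simp: resolution)
  qed
  have "(\<Sum>l\<in>UNIV. \<Sum>i\<in>UNIV. (y l * q i) \<odot> mon z (m # ms) l i) = (\<Sum>l\<in>UNIV. \<Sum>d\<in>UNIV. y l \<odot> (lax m z l d * c d))"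
    by (simp add: c_def sum_2 distrib_left distrib_right cscale_distribs add_ac)
  also have "\<dots> = (\<Sum>l\<in>UNIV. \<Sum>d\<in>UNIV. (y l * q d) \<odot> lax m z l d) * D + (\<Sum>l\<in>UNIV. \<Sum>d\<in>UNIV. (y l * p d) \<odot> lax m z l d) * C"
    unfolding c_split by (simp add: sum_2 distrib_left distrib_right cscale_distribs add_ac)
  also have "(\<Sum>l\<in>UNIV. \<Sum>d\<in>UNIV. (y l * q d) \<odot> lax m z l d) = \<alpha>"
    by (simp add: lax_contract dual \<alpha>_def \<pi>_def)
  also have "(\<Sum>l\<in>UNIV. \<Sum>d\<in>UNIV. (y l * p d) \<odot> lax m z l d) = \<eta> \<odot> \<rho>"
    by (simp add: lax_contract dual \<rho>_def)
  finally show ?case using W by auto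
qed

end

section \<open>Matrix elements of the transfer operator\<close>

lemma sum_PiE_insert:
  assumes "a \<notin> A"
  shows "(\<Sum>f\<in>insert a A \<rightarrow>\<^sub>E (UNIV :: 2 set). F f) = (\<Sum>b\<in>UNIV. \<Sum>f\<in>A \<rightarrow>\<^sub>E UNIV. F (f(a := b)))"
proof -
  have "(\<Sum>f\<in>insert a A \<rightarrow>\<^sub>E (UNIV :: 2 set). F f)
    = sum F ((\<lambda>(b, f). f(a := b)) ` (UNIV \<times> (A \<rightarrow>\<^sub>E UNIV)))"
    by (simp add: PiE_insert_eq)
  also have "\<dots> = (\<Sum>(b, f)\<in>UNIV \<times> (A \<rightarrow>\<^sub>E UNIV). F (f(a := b)))"
    using inj_combinator[OF assms, of "\<lambda>_. UNIV :: 2 set"]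
    by (subst sum.reindex) (auto simp: case_prod_beta)
  also have "\<dots> = (\<Sum>b\<in>UNIV. \<Sum>f\<in>A \<rightarrow>\<^sub>E UNIV. F (f(a := b)))"
    by (rule sum.cartesian_product[symmetric])
  finally show ?thesis .
qed

definition overlay :: "nat \<Rightarrow> (nat \<Rightarrow> 2) \<Rightarrow> (nat \<Rightarrow> 2) \<Rightarrow> nat \<Rightarrow> 2" where
  "overlay N s' s = (\<lambda>n. if n < N then s' n else s n)"

lemma overlay_Suc: "overlay (Suc N) (s'(N := b)) s = overlay N s' (s(N := b))"
  by (auto simp: overlay_def fun_eq_iff)

context chain
begin

lemma app_lax: "(lax m z i d \<rhd> w) s = (\<Sum>b\<in>UNIV. Rloc \<eta> (z - \<xi> m) i (s m) d b * w (s(m := b)))"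
proof -
  have "s m = 1 \<or> s m = 2" by (rule exhaust_2)
  then have "s(m := 1) = s \<and> s m = 1 \<or> s(m := 2) = s \<and> s m = 2" by (metis fun_upd_triv)
  then show ?thesis
    using exhaust_2[of i] exhaust_2[of d]
    by (auto simp: lax_def munit_def app_op app_cscale sub.rep_eq mul.rep_eq Rloc_def sum_2 algebra_simps)
qed

text \<open>Path expansion: \<open>c\<close> lists the auxiliary indices between consecutive
  factors, from \<open>c 0\<close> at the right end of the product to \<open>c N\<close> at the left
  end.\<close>

lemma app_mon:
  "(mon z (rev [0..<N]) i j \<rhd> v) s = (\<Sum>s'\<in>states N. \<Sum>c\<in>{..N} \<rightarrow>\<^sub>E UNIV.
    (if c N = i \<and> c 0 = j then \<Prod>n<N. Rloc \<eta> (z - \<xi> n) (c (Suc n)) (s n) (c n) (s' n) else 0)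
      * v (overlay N s' s))"
proof (induction N arbitrary: i s)
  case 0
  have "(\<Sum>c\<in>{0} \<rightarrow>\<^sub>E UNIV. F c) = (\<Sum>b\<in>UNIV. F (\<lambda>a. if a = 0 then b else undefined))"
    for F :: "(nat \<Rightarrow> 2) \<Rightarrow> complex"
    using sum_PiE_insert[of 0 "{}" F] by simp
  then show ?case
    using exhaust_2[of i] exhaust_2[of j] by (auto simp: states_def overlay_def app_op sum_2)
next
  case (Suc N)
  let ?P = "\<lambda>c s'. \<Prod>n<N. Rloc \<eta> (z - \<xi> n) (c (Suc n)) (s n) (c n) (s' n)"
  let ?R = "\<lambda>d b. Rloc \<eta> (z - \<xi> N) i (s N) d b"
  have "(mon z (rev [0..<Suc N]) i j \<rhd> v) s
    = (\<Sum>d\<in>UNIV. \<Sum>b\<in>UNIV. ?R d b * (mon z (rev [0..<N]) d j \<rhd> v) (s(N := b)))"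
    by (simp add: app_sum_op app_op app_lax)
  also have "\<dots> = (\<Sum>d\<in>UNIV. \<Sum>b\<in>UNIV. \<Sum>s'\<in>states N. \<Sum>c\<in>{..N} \<rightarrow>\<^sub>E UNIV.
      (if c N = d then if c 0 = j then ?R d b * ?P c s' else 0 else 0) * v (overlay N s' (s(N := b))))"
    unfolding Suc.IH sum_distrib_left
    by (intro sum.cong refl) (auto intro!: prod.cong)
  also have "\<dots> = (\<Sum>b\<in>UNIV. \<Sum>s'\<in>states N. \<Sum>c\<in>{..N} \<rightarrow>\<^sub>E UNIV. \<Sum>d\<in>UNIV.
      (if c N = d then if c 0 = j then ?R d b * ?P c s' else 0 else 0) * v (overlay N s' (s(N := b))))"
    by (simp only: sum_2 sum.distrib add_ac)
  also have "\<dots> = (\<Sum>b\<in>UNIV. \<Sum>s'\<in>states N. \<Sum>c\<in>{..N} \<rightarrow>\<^sub>E UNIV.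
      (if c 0 = j then ?R (c N) b * ?P c s' else 0) * v (overlay N s' (s(N := b))))"
    by (simp add: sum.delta flip: sum_distrib_right)
  \<comment> \<open>The new end \<open>e\<close> of the path is forced to be \<open>i\<close>; the
    redundant sum over it brings the expression into the form of
    \<open>sum_PiE_insert\<close>.\<close>
  also have "\<dots> = (\<Sum>b\<in>UNIV. \<Sum>s'\<in>states N. \<Sum>e\<in>UNIV. \<Sum>c\<in>{..N} \<rightarrow>\<^sub>E UNIV.
      (if e = i then if c 0 = j then ?R (c N) b * ?P c s' else 0 else 0) * v (overlay N s' (s(N := b))))"
    using exhaust_2[of i] by (auto simp: sum_2)
  also have "\<dots> = (\<Sum>b\<in>UNIV. \<Sum>s'\<in>states N. \<Sum>e\<in>UNIV. \<Sum>c\<in>{..N} \<rightarrow>\<^sub>E UNIV.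
      (if (c(Suc N := e)) (Suc N) = i \<and> (c(Suc N := e)) 0 = j then
        \<Prod>n<Suc N. Rloc \<eta> (z - \<xi> n) ((c(Suc N := e)) (Suc n)) (s n) ((c(Suc N := e)) n) ((s'(N := b)) n) else 0)
       * v (overlay (Suc N) (s'(N := b)) s))"
    by (intro sum.cong refl) (auto simp: overlay_Suc mult.commute intro!: prod.cong)
  also have "\<dots> = (\<Sum>s'\<in>states (Suc N). \<Sum>c\<in>{..Suc N} \<rightarrow>\<^sub>E UNIV.
    (if c (Suc N) = i \<and> c 0 = j then \<Prod>n<Suc N. Rloc \<eta> (z - \<xi> n) (c (Suc n)) (s n) (c n) (s' n) else 0)
      * v (overlay (Suc N) s' s))"
  proof -
    have "(\<Sum>f\<in>states (Suc N). F f) = (\<Sum>b\<in>UNIV. \<Sum>f\<in>states N. F (f(N := b)))"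
      for F :: "(nat \<Rightarrow> 2) \<Rightarrow> complex"
      unfolding states_def lessThan_Suc by (rule sum_PiE_insert) simp
    moreover have "(\<Sum>c\<in>{..Suc N} \<rightarrow>\<^sub>E UNIV. F c) = (\<Sum>e\<in>UNIV. \<Sum>c\<in>{..N} \<rightarrow>\<^sub>E UNIV. F (c(Suc N := e)))"
      for F :: "(nat \<Rightarrow> 2) \<Rightarrow> complex"
      unfolding atMost_Suc by (rule sum_PiE_insert) simp
    ultimately show ?thesis by (simp only:)
  qed
  finally show ?case .
qed

definition transfer_op :: "complex^2^2 \<Rightarrow> nat \<Rightarrow> complex \<Rightarrow> chain_op" where
  "transfer_op K N z = (\<Sum>i\<in>UNIV. \<Sum>j\<in>UNIV. K $ j $ i \<odot> mon z (rev [0..<N]) i j)"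

text \<open>The twisted trace closes the paths of \<open>app_mon\<close>; spins from
  \<open>N\<close> on are left as they are in \<open>s\<close>.\<close>

lemma app_transfer_op:
  "(transfer_op K N z \<rhd> v) s = (\<Sum>s'\<in>states N. transfer \<eta> \<xi> K N z s s' * v (overlay N s' s))"
proof -
  let ?P = "\<lambda>c s'. \<Prod>n<N. Rloc \<eta> (z - \<xi> n) (c (Suc n)) (s n) (c n) (s' n)"
  have "(transfer_op K N z \<rhd> v) s = (\<Sum>i\<in>UNIV. \<Sum>j\<in>UNIV. \<Sum>s'\<in>states N. \<Sum>c\<in>{..N} \<rightarrow>\<^sub>E UNIV.
      K $ j $ i * ((if c N = i \<and> c 0 = j then ?P c s' else 0) * v (overlay N s' s)))"
    by (simp add: transfer_op_def app_sum_op app_cscale app_mon sum_distrib_left)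
  also have "\<dots> = (\<Sum>s'\<in>states N. \<Sum>c\<in>{..N} \<rightarrow>\<^sub>E UNIV. \<Sum>i\<in>UNIV. \<Sum>j\<in>UNIV.
      K $ j $ i * ((if c N = i \<and> c 0 = j then ?P c s' else 0) * v (overlay N s' s)))"
    by (simp only: sum_2 sum.distrib add_ac)
  also have "\<dots> = (\<Sum>s'\<in>states N. \<Sum>c\<in>{..N} \<rightarrow>\<^sub>E UNIV. K $ (c 0) $ (c N) * ?P c s' * v (overlay N s' s))"
  proof (intro sum.cong refl)
    fix s' and c :: "nat \<Rightarrow> 2"
    show "(\<Sum>i\<in>UNIV. \<Sum>j\<in>UNIV. K $ j $ i * ((if c N = i \<and> c 0 = j then ?P c s' else 0) * v (overlay N s' s)))
      = K $ (c 0) $ (c N) * ?P c s' * v (overlay N s' s)"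
      using exhaust_2[of "c N"] exhaust_2[of "c 0"] by (auto simp: sum_2)
  qed
  finally show ?thesis by (simp add: transfer_def sum_distrib_right)
qed

end

section \<open>Interpolation\<close>

lemma dfun_node: "a < N \<Longrightarrow> dfun y N (y a) = 0"
  by (auto simp: dfun_def)

lemma gfun_node:
  assumes "inj_on y {..<N}" "a < N" "b < N"
  shows "gfun y N b (y a) = (if b = a then 1 else 0)"
proof (cases "b = a")
  case True
  then show ?thesis using assms by (auto simp: gfun_def inj_on_eq_iff[OF assms(1)] intro!: prod.neutral)
next
  case False
  then show ?thesis using assms by (auto simp: gfun_def intro!: bexI[of _ a])
qed

text \<open>Both sides have degree at most \<open>N\<close> and the same coefficient of
  \<open>z ^ N\<close>, and they agree at the \<open>N\<close> nodes.\<close>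

lemma lagrange_interpolation:
  fixes y c :: "nat \<Rightarrow> complex"
  assumes inj: "inj_on y {..<N}"
  shows "(\<Sum>k\<le>N. c k * z ^ k) = c N * dfun y N z + (\<Sum>a<N. gfun y N a z * (\<Sum>k\<le>N. c k * y a ^ k))"
proof -
  define p where "p = (\<Sum>k\<le>N. monom (c k) k)"
  define d where "d = (\<Prod>a<N. [:- y a, 1:])"
  define g where "g a = (\<Prod>b\<in>{..<N} - {a}. smult (1 / (y a - y b)) [:- y b, 1:])" for a
  define q where "q = smult (c N) d + (\<Sum>a<N. smult (poly p (y a)) (g a))"
  have poly_p: "poly p z = (\<Sum>k\<le>N. c k * z ^ k)" for z
    by (simp add: p_def poly_sum poly_monom)
  have poly_d: "poly d z = dfun y N z" for z
    by (simp add: d_def poly_prod dfun_def)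
  have poly_g: "poly (g a) z = gfun y N a z" for a z
    by (simp add: g_def poly_prod gfun_def algebra_simps diff_divide_distrib)
  have deg_d: "degree d = N"
    unfolding d_def by (subst degree_prod_eq_sum_degree) auto
  have lc_d: "coeff d N = 1"
    using lead_coeff_prod[of "\<lambda>a. [:- y a, 1:]" "{..<N}"] deg_d by (simp add: d_def)
  have deg_g: "degree (g a) < N" if "a < N" for a
  proof -
    have "degree (g a) \<le> (\<Sum>b\<in>{..<N} - {a}. degree (smult (1 / (y a - y b)) [:- y b, 1:]))"
      using degree_prod_sum_le[of "{..<N} - {a}" "\<lambda>b. smult (1 / (y a - y b)) [:- y b, 1:]"]
      by (simp add: g_def o_def)
    also have "\<dots> \<le> (\<Sum>b\<in>{..<N} - {a}. 1)"
      by (intro sum_mono) auto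
    also have "\<dots> < N" using that by simp
    finally show ?thesis .
  qed
  have "p = q"
  proof (rule poly_eqI_degree_lead_coeff[of _ N _ "y ` {..<N}"])
    have "coeff p N = c N" by (simp add: p_def coeff_sum coeff_monom)
    moreover have "coeff q N = c N"
      using deg_g by (simp add: q_def coeff_sum lc_d coeff_eq_0)
    ultimately show "coeff p N = coeff q N" by simp
    show "N \<le> card (y ` {..<N})" using inj by (simp add: card_image)
    show "degree p \<le> N" unfolding p_def by (intro degree_sum_le) (auto intro: order_trans[OF degree_monom_le])
    show "degree q \<le> N"
      unfolding q_def using deg_d deg_g
      by (intro degree_add_le degree_sum_le) (auto intro: order_trans[OF degree_smult_le] less_imp_le)
  next
    fix w assume "w \<in> y ` {..<N}"
    then obtain a where a: "a < N" "w = y a" by auto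
    have "(\<Sum>b<N. poly p (y b) * gfun y N b (y a)) = (\<Sum>b<N. if b = a then poly p (y a) else 0)"
      using a by (intro sum.cong) (auto simp: gfun_node[OF inj])
    then show "poly p w = poly q w"
      using a by (simp add: q_def poly_sum poly_d poly_g dfun_node)
  qed
  then have "poly p z = poly q z" by simp
  then show ?thesis
    by (simp add: q_def poly_sum poly_d poly_g poly_p mult.commute)
qed

section \<open>Polynomials with operator coefficients\<close>

lemma sum_up_to_Suc_shift:
  fixes f :: "nat \<Rightarrow> 'a :: comm_monoid_add"
  assumes "f 0 = 0"
  shows "(\<Sum>k\<le>Suc n. f k) = (\<Sum>k\<le>n. f (Suc k))"
  using assms by (simp add: sum.atMost_Suc_shift del: sum.atMost_Suc)

text \<open>\<open>C\<close> is the coefficient of \<open>z ^ n\<close> and may be zero. It is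
  recorded because \<open>n\<close> nodes determine a polynomial of degree at most \<open>n\<close>
  only together with this coefficient.\<close>

definition poly_op :: "nat \<Rightarrow> (complex \<Rightarrow> chain_op) \<Rightarrow> chain_op \<Rightarrow> bool" where
  "poly_op n A C \<longleftrightarrow> (\<exists>c. (\<forall>z. A z = (\<Sum>k\<le>n. z ^ k \<odot> c k)) \<and> c n = C)"

lemma poly_op_const: "poly_op 0 (\<lambda>z. C) C"
  unfolding poly_op_def by (rule exI[of _ "\<lambda>_. C"]) simp

lemma poly_op_add: "poly_op n A C \<Longrightarrow> poly_op n B D \<Longrightarrow> poly_op n (\<lambda>z. A z + B z) (C + D)"
  unfolding poly_op_def
proof (elim exE conjE)
  fix c d assume "\<forall>z. A z = (\<Sum>k\<le>n. z ^ k \<odot> c k)" "c n = C" "\<forall>z. B z = (\<Sum>k\<le>n. z ^ k \<odot> d k)" "d n = D"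
  then show "\<exists>c. (\<forall>z. A z + B z = (\<Sum>k\<le>n. z ^ k \<odot> c k)) \<and> c n = C + D"
    by (intro exI[of _ "\<lambda>k. c k + d k"]) (simp add: cscale_add_right sum.distrib)
qed

lemma poly_op_mult_left: "poly_op n A C \<Longrightarrow> poly_op n (\<lambda>z. B * A z) (B * C)"
  unfolding poly_op_def
proof (elim exE conjE)
  fix c assume "\<forall>z. A z = (\<Sum>k\<le>n. z ^ k \<odot> c k)" "c n = C"
  then show "\<exists>c. (\<forall>z. B * A z = (\<Sum>k\<le>n. z ^ k \<odot> c k)) \<and> c n = B * C"
    by (intro exI[of _ "\<lambda>k. B * c k"]) (simp add: sum_distrib_left)
qed

lemma poly_op_cscale: "poly_op n A C \<Longrightarrow> poly_op n (\<lambda>z. a \<odot> A z) (a \<odot> C)"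
  using poly_op_mult_left[of n A C "a \<odot> 1"] by simp

lemma poly_op_sum:
  "finite I \<Longrightarrow> (\<And>i. i \<in> I \<Longrightarrow> poly_op n (A i) (C i)) \<Longrightarrow> poly_op n (\<lambda>z. \<Sum>i\<in>I. A i z) (\<Sum>i\<in>I. C i)"
proof (induction I rule: finite_induct)
  case empty
  show ?case unfolding poly_op_def by (rule exI[of _ "\<lambda>_. 0"]) simp
qed (auto intro: poly_op_add)

lemma poly_op_Suc: "poly_op n A C \<Longrightarrow> poly_op (Suc n) A 0"
  unfolding poly_op_def
proof (elim exE conjE)
  fix c assume "\<forall>z. A z = (\<Sum>k\<le>n. z ^ k \<odot> c k)"
  then show "\<exists>c. (\<forall>z. A z = (\<Sum>k\<le>Suc n. z ^ k \<odot> c k)) \<and> c (Suc n) = 0"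
    by (intro exI[of _ "c(Suc n := 0)"]) (auto intro!: sum.cong)
qed

lemma poly_op_shift: "poly_op n A C \<Longrightarrow> poly_op (Suc n) (\<lambda>z. (z - a) \<odot> A z) C"
proof -
  assume *: "poly_op n A C"
  then obtain c where c: "\<And>z. A z = (\<Sum>k\<le>n. z ^ k \<odot> c k)" "c n = C"
    unfolding poly_op_def by blast
  have "poly_op (Suc n) (\<lambda>z. z \<odot> A z) C"
    unfolding poly_op_def
  proof (intro exI[of _ "case_nat 0 c"] conjI allI)
    show "z \<odot> A z = (\<Sum>k\<le>Suc n. z ^ k \<odot> case_nat 0 c k)" for z
      by (subst sum_up_to_Suc_shift) (auto simp: c cscale_sum_right)
  qed (simp add: c)
  moreover have "poly_op (Suc n) (\<lambda>z. (- a) \<odot> A z) ((- a) \<odot> 0)"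
    using * by (intro poly_op_cscale poly_op_Suc)
  ultimately have "poly_op (Suc n) (\<lambda>z. z \<odot> A z + (- a) \<odot> A z) (C + (- a) \<odot> 0)"
    by (rule poly_op_add)
  then show ?thesis by (simp add: cscale_diff_left)
qed

lemma poly_op_interpolation:
  assumes "poly_op N A C" "inj_on y {..<N}"
  shows "A z = dfun y N z \<odot> C + (\<Sum>a<N. gfun y N a z \<odot> A (y a))"
proof -
  obtain c where c: "\<And>z. A z = (\<Sum>k\<le>N. z ^ k \<odot> c k)" "c N = C"
    using assms(1) unfolding poly_op_def by blast
  show ?thesis
  proof (rule chain_op_eqI)
    fix v s
    have A: "(A z \<rhd> v) s = (\<Sum>k\<le>N. (c k \<rhd> v) s * z ^ k)" for z
      unfolding c by (simp add: app_sum_op app_cscale mult.commute)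
    show "(A z \<rhd> v) s = ((dfun y N z \<odot> C + (\<Sum>a<N. gfun y N a z \<odot> A (y a))) \<rhd> v) s"
      using lagrange_interpolation[OF assms(2), of "\<lambda>k. (c k \<rhd> v) s" z]
      by (simp add: app_op app_sum_op app_cscale A c(2) mult.commute)
  qed
qed

text \<open>Each Lax factor contributes one power of \<open>z\<close>, only through its diagonal
  part, so the leading coefficient is the identity of the auxiliary space.\<close>

lemma (in chain) poly_op_mon:
  "poly_op (length ms) (\<lambda>z. mon z ms i j) (if i = j then 1 else 0)"
proof (induction ms arbitrary: i)
  case Nil
  show ?case by (simp add: poly_op_const)
next
  case (Cons m ms)
  have eq: "mon z (m # ms) i j = (z - \<xi> m) \<odot> mon z ms i j + (\<Sum>d\<in>UNIV. (\<eta> \<odot> munit m d i) * mon z ms d j)" for z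
    using exhaust_2[of i] by (auto simp: lax_def sum_2 distrib_right add_ac)
  have "poly_op (Suc (length ms)) (\<lambda>z. mon z (m # ms) i j) ((if i = j then 1 else 0) + (\<Sum>d\<in>(UNIV::2 set). 0))"
    unfolding eq
    using poly_op_Suc[OF poly_op_mult_left[OF Cons.IH]]
    by (intro poly_op_add poly_op_shift Cons.IH poly_op_sum) (auto simp del: cscale_times)
  then show ?case by simp
qed

section \<open>Interpolation, commutation and fusion of the transfer operator\<close>

locale spin_chain = chain +
  fixes K :: "complex^2^2" and N :: nat
  assumes eta_nz: "\<eta> \<noteq> 0"
    and xi_gen: "\<And>a b. a < N \<Longrightarrow> b < N \<Longrightarrow> a \<noteq> b \<Longrightarrow>
      \<xi> a \<noteq> \<xi> b \<and> \<xi> a \<noteq> \<xi> b + \<eta> \<and> \<xi> a \<noteq> \<xi> b - \<eta>"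
begin

abbreviation T :: "complex \<Rightarrow> chain_op" where
  "T \<equiv> transfer_op K N"

text \<open>The leading coefficient of the monodromy, traced against \<open>K\<close>, is
  \<open>trace K\<close>. The nodes are left free since both the \<open>\<xi> a\<close> and shifted
  nodes serve later.\<close>

lemma T_interpolation:
  assumes "inj_on y {..<N}"
  shows "T z = (trace K * dfun y N z) \<odot> 1 + (\<Sum>a<N. gfun y N a z \<odot> T (y a))"
proof -
  have "poly_op N T (\<Sum>i\<in>UNIV. \<Sum>j\<in>UNIV. K $ j $ i \<odot> (if i = j then 1 else 0))"
    unfolding transfer_op_def using poly_op_mon[of "rev [0..<N]"]
    by (intro poly_op_sum poly_op_cscale) auto
  moreover have "(\<Sum>i\<in>UNIV. \<Sum>j\<in>UNIV. K $ j $ i \<odot> (if i = j then 1 else 0)) = trace K \<odot> 1"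
    by (simp add: trace_def sum_2 cscale_add_left)
  ultimately show ?thesis
    using poly_op_interpolation[OF _ assms, of T "trace K \<odot> 1" z] by (simp add: mult.commute)
qed

text \<open>Genericity excludes the differences \<eta> and -\<eta>, at which the two contracted
  exchange relations would no longer force the commutator to vanish.\<close>

lemma T_commutes:
  assumes "a < N" "b < N"
  shows "commutes (T (\<xi> a)) (T (\<xi> b))"
proof (cases "a = b")
  case True
  then show ?thesis by (simp add: commutes_def)
next
  case False
  then have "\<xi> a - \<xi> b \<noteq> \<eta>" "\<xi> a - \<xi> b \<noteq> - \<eta>"
    using xi_gen[OF assms False] by (auto simp: algebra_simps)
  then have "(\<xi> a - \<xi> b)\<^sup>2 \<noteq> \<eta>\<^sup>2" by (simp add: power2_eq_iff)
  then show ?thesis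
    unfolding transfer_op_def by (intro rtt_imp_commutes_trace[OF rtt_mon]) auto
qed

text \<open>The monodromies at these two points satisfy \<open>anti\<close>, and their quantum
  determinant is the product over all sites.\<close>

lemma T_fusion:
  assumes "n < N"
  shows "T (\<xi> n) * T (\<xi> n - \<eta>) = (afun \<eta> \<xi> N (\<xi> n) * dfun \<xi> N (\<xi> n - \<eta>) * det K) \<odot> 1"
proof -
  have "anti (mon (\<xi> n) (rev [0..<N])) (mon (\<xi> n - \<eta>) (rev [0..<N]))"
    using assms eta_nz by (intro anti_mon) auto
  moreover have "(\<Prod>m\<in>set (rev [0..<N]). (\<xi> n + \<eta> - \<xi> m) * (\<xi> n - \<eta> - \<xi> m))
    = afun \<eta> \<xi> N (\<xi> n) * dfun \<xi> N (\<xi> n - \<eta>)"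
    by (simp add: prod.distrib afun_def dfun_def atLeast0LessThan)
  ultimately show ?thesis
    unfolding transfer_op_def det_2
    by (subst trace_fusion[OF _ mon_qdet]) (auto simp: mult_ac)
qed

text \<open>A coincidence of two nodes would give \<open>\<xi> a - \<xi> b = r * \<eta>\<close> with
  \<open>r = h a - h b\<close> in {-1, 0, 1}; this is the excluded range.\<close>

lemma shifted_nodes_inj:
  assumes "\<And>a. a < N \<Longrightarrow> h a \<in> {0, 1::nat}"
  shows "inj_on (\<lambda>a. \<xi> a - of_nat (h a) * \<eta>) {..<N}"
proof (rule inj_onI)
  fix a b assume ab: "a \<in> {..<N}" "b \<in> {..<N}" "\<xi> a - of_nat (h a) * \<eta> = \<xi> b - of_nat (h b) * \<eta>"
  show "a = b"
  proof (rule ccontr)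
    assume "a \<noteq> b"
    then show False
      using xi_gen[of a b] ab assms[of a] assms[of b] by (auto simp: algebra_simps)
  qed
qed

end

section \<open>Cyclicity of a product covector\<close>

lemma app_app: "A \<rhd> B \<rhd> v = (A * B) \<rhd> v"
  by (simp add: app_op)

lemma commutes_appD: "commutes A B \<Longrightarrow> A \<rhd> B \<rhd> v = B \<rhd> A \<rhd> v"
  by (simp add: commutes_def app_app)

lemma contr_app: "contr n w \<rhd> f = (\<lambda>s. \<Sum>i\<in>UNIV. w i * (sub n i \<rhd> f) s)"
  by (simp add: contr_def fun_eq_iff app_sum_op app_cscale)

locale cyclic_chain = framed_chain \<eta> \<xi> x y p q + spin_chain \<eta> \<xi> K N
  for \<eta> :: complex and \<xi> :: "nat \<Rightarrow> complex" and x y p q :: "2 \<Rightarrow> complex"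
    and K :: "complex^2^2" and N :: nat +
  assumes y_eq: "y l = (\<Sum>c\<in>UNIV. x c * K $ c $ l)"
begin

text \<open>At \<open>n = N\<close> this is the pairing with the product covector
  \<open>x \<otimes> ... \<otimes> x\<close>.\<close>

fun contr_below :: "nat \<Rightarrow> chain_op" where
  "contr_below 0 = 1"
| "contr_below (Suc n) = contr n x * contr_below n"

definition X :: "nat \<Rightarrow> 2 \<Rightarrow> 2 \<Rightarrow> chain_op" where
  "X n = mon (\<xi> n) (rev [Suc n..<N])"

text \<open>The remnant of \<open>T (\<xi> n)\<close>, up to \<open>\<kappa> n\<close>, once the
  sites up to \<open>n\<close> are paired with \<open>x\<close>: spin \<open>n\<close> feeds the
  right index of \<open>X n\<close>, and \<open>y\<close> closes the left one.\<close>

definition G :: "nat \<Rightarrow> chain_op" where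
  "G n = (\<Sum>l\<in>UNIV. \<Sum>i\<in>UNIV. y l \<odot> (X n l i * sub n i))"

text \<open>The factor \<eta> comes from the permutation at site \<open>n\<close>, the others from
  the eigenvalues of the R-matrices of the sites below on \<open>x \<otimes> x\<close>.\<close>

definition \<kappa> :: "nat \<Rightarrow> complex" where
  "\<kappa> n = \<eta> * (\<Prod>m<n. \<xi> n - \<xi> m + \<eta>)"

lemma \<kappa>_nonzero: "n < N \<Longrightarrow> \<kappa> n \<noteq> 0"
proof -
  assume n: "n < N"
  have "\<xi> n - \<xi> m + \<eta> \<noteq> 0" if "m < n" for m
    using xi_gen[of n m] n that by (auto simp: algebra_simps)
  then show ?thesis using eta_nz by (simp add: \<kappa>_def)
qed

lemma commutes_contr_below_munit: "n \<le> m \<Longrightarrow> commutes (contr_below n) (munit m a b)"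
proof (induction n)
  case 0
  show ?case by (simp add: commutes_def)
next
  case (Suc n)
  then have "commutes (munit m a b) (contr n x * contr_below n)"
    by (intro commutes_mult commutes_sym[OF commutes_contr_munit]) (auto intro: commutes_sym)
  then show ?case by (simp add: commutes_sym)
qed

text \<open>The permutation fixes \<open>x \<otimes> x\<close>, so the R-matrix multiplies it by a
  scalar.\<close>

lemma contr_lax_row:
  "contr n x * (\<Sum>d\<in>UNIV. x d \<odot> lax n z d e) = (x e * (z - \<xi> n + \<eta>)) \<odot> contr n x"
proof -
  have "contr n x * (\<Sum>d\<in>UNIV. x d \<odot> lax n z d e)
    = (x e * (z - \<xi> n)) \<odot> contr n x + (\<Sum>d\<in>UNIV. (x d * \<eta>) \<odot> (contr n x * munit n e d))"
    using exhaust_2[of e] by (auto simp: lax_def sum_2 distrib_left cscale_add_right add_ac)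
  also have "(\<Sum>d\<in>UNIV. (x d * \<eta>) \<odot> (contr n x * munit n e d)) = (x e * \<eta>) \<odot> contr n x"
    by (simp add: contr_munit) (simp add: contr_def cscale_sum_right mult_ac)
  finally show ?thesis by (simp add: cscale_add_left distrib_left)
qed

lemma contr_below_row:
  "contr_below n * (\<Sum>d\<in>UNIV. x d \<odot> mon z (rev [0..<n]) d e) = (x e * (\<Prod>m<n. z - \<xi> m + \<eta>)) \<odot> contr_below n"
proof (induction n)
  case 0
  show ?case using exhaust_2[of e] by (auto simp: sum_2)
next
  case (Suc n)
  let ?Y = "mon z (rev [0..<n])"
  have com: "contr_below n * lax n z d f = lax n z d f * contr_below n" for d f
    using commutes_lax[of "contr_below n" n] commutes_contr_below_munit[of n n] by (simp add: commutes_def)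
  have "contr_below (Suc n) * (\<Sum>d\<in>UNIV. x d \<odot> mon z (rev [0..<Suc n]) d e)
    = (\<Sum>f\<in>UNIV. (\<Sum>d\<in>UNIV. x d \<odot> (contr n x * (contr_below n * lax n z d f) * ?Y f e)))"
    by (simp add: sum_2 distrib_left cscale_add_right mult.assoc add_ac)
  also have "\<dots> = (\<Sum>f\<in>UNIV. (contr n x * (\<Sum>d\<in>UNIV. x d \<odot> lax n z d f)) * (contr_below n * ?Y f e))"
    unfolding com by (simp add: sum_2 distrib_left distrib_right mult.assoc)
  also have "\<dots> = (z - \<xi> n + \<eta>) \<odot> (contr n x * (contr_below n * (\<Sum>f\<in>UNIV. x f \<odot> ?Y f e)))"
    unfolding contr_lax_row by (simp add: sum_2 distrib_left cscale_add_right mult.assoc mult.commute)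
  also have "\<dots> = (x e * (\<Prod>m<Suc n. z - \<xi> m + \<eta>)) \<odot> contr_below (Suc n)"
    unfolding Suc.IH by (simp add: mult_ac)
  finally show ?case .
qed

text \<open>At \<open>\<xi> n\<close> the Lax matrix of site \<open>n\<close> is \<eta> times the
  permutation: spin \<open>n\<close> enters \<open>X n\<close>, while \<open>x\<close> moves to the
  auxiliary line, crosses the lower sites with scalar factors and becomes \<open>y\<close> at the
  twist.\<close>

lemma contr_below_T:
  assumes "n < N"
  shows "contr_below (Suc n) * T (\<xi> n) = \<kappa> n \<odot> (G n * contr_below n)"
proof -
  let ?Y = "mon (\<xi> n) (rev [0..<n])"
  have "[0..<N] = [0..<n] @ n # [Suc n..<N]"
    using assms upt_add_eq_append[of 0 n "N - n"] by (simp add: upt_conv_Cons)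
  then have rev: "rev [0..<N] = rev [Suc n..<N] @ n # rev [0..<n]" by simp
  have lax_n: "lax n (\<xi> n) d f = \<eta> \<odot> munit n f d" for d f
    by (simp add: lax_def)
  have mon_eq: "mon (\<xi> n) (rev [0..<N]) i j = \<eta> \<odot> (\<Sum>d\<in>UNIV. \<Sum>f\<in>UNIV. X n i d * munit n f d * ?Y f j)" for i j
    unfolding rev mon_append by (simp add: X_def lax_n sum_2 distrib_left cscale_add_right mult.assoc)
  have comX: "contr_below (Suc n) * X n i d = X n i d * contr_below (Suc n)" for i d
    unfolding X_def using commutes_mon[of "rev [Suc n..<N]" "contr_below (Suc n)" "\<xi> n" i d] commutes_contr_below_munit[of "Suc n"]
    by (auto simp: commutes_def)
  have com: "contr_below n * munit n f d = munit n f d * contr_below n" for f d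
    using commutes_contr_below_munit[of n n] by (simp add: commutes_def)
  have "contr_below (Suc n) * (X n i d * munit n f d * ?Y f j) = x f \<odot> (X n i d * sub n d * (contr_below n * ?Y f j))" for i j d f
  proof -
    have "contr_below (Suc n) * (X n i d * munit n f d * ?Y f j) = X n i d * (contr n x * (contr_below n * munit n f d)) * ?Y f j"
      by (simp only: comX mult.assoc[symmetric]) (simp add: mult.assoc)
    also have "\<dots> = X n i d * (contr n x * munit n f d) * (contr_below n * ?Y f j)"
      unfolding com by (simp add: mult.assoc)
    finally show ?thesis by (simp add: contr_munit mult.assoc)
  qed
  then have "contr_below (Suc n) * mon (\<xi> n) (rev [0..<N]) i j
    = \<eta> \<odot> (\<Sum>d\<in>UNIV. X n i d * sub n d * (contr_below n * (\<Sum>f\<in>UNIV. x f \<odot> ?Y f j)))" for i j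
    unfolding mon_eq times_cscale sum_distrib_left by (simp add: cscale_sum_right)
  also have "\<eta> \<odot> (\<Sum>d\<in>UNIV. X n i d * sub n d * (contr_below n * (\<Sum>f\<in>UNIV. x f \<odot> ?Y f j)))
    = (\<kappa> n * x j) \<odot> (\<Sum>d\<in>UNIV. X n i d * sub n d * contr_below n)" for i j
    unfolding contr_below_row by (simp add: \<kappa>_def cscale_sum_right mult_ac)
  finally have row: "contr_below (Suc n) * mon (\<xi> n) (rev [0..<N]) i j = (\<kappa> n * x j) \<odot> (\<Sum>d\<in>UNIV. X n i d * sub n d * contr_below n)" for i j .
  have "contr_below (Suc n) * T (\<xi> n) = (\<Sum>i\<in>UNIV. \<Sum>j\<in>UNIV. K $ j $ i \<odot> (contr_below (Suc n) * mon (\<xi> n) (rev [0..<N]) i j))"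
    unfolding transfer_op_def sum_distrib_left by (simp only: times_cscale)
  also have "\<dots> = (\<Sum>i\<in>UNIV. (\<kappa> n * y i) \<odot> (\<Sum>d\<in>UNIV. X n i d * sub n d * contr_below n))"
    unfolding row y_eq by (simp add: sum_distrib_left cscale_sum_left mult_ac)
  also have "\<dots> = \<kappa> n \<odot> (G n * contr_below n)"
    by (simp add: G_def sum_2 distrib_right cscale_add_right)
  finally show ?thesis .
qed

text \<open>By duality of the frame \<open>f0\<close> and \<open>g\<close> are the contractions of
  \<open>f\<close> at site \<open>n\<close> with \<open>x\<close> and \<open>y\<close>; the operator
  in front of \<open>g\<close> is the invertible corner.\<close>

lemma G_split:
  assumes "\<And>i. sub n i \<rhd> f = (\<lambda>s. p i * f0 s + q i * g s)"
  shows "G n \<rhd> f = (\<lambda>s. ((\<Sum>l\<in>UNIV. \<Sum>i\<in>UNIV. (y l * p i) \<odot> X n l i) \<rhd> f0) s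
    + ((\<Sum>l\<in>UNIV. \<Sum>i\<in>UNIV. (y l * q i) \<odot> X n l i) \<rhd> g) s)"
proof
  fix s
  have "(G n \<rhd> f) s = (\<Sum>l\<in>UNIV. \<Sum>i\<in>UNIV. y l * (p i * (X n l i \<rhd> f0) s + q i * (X n l i \<rhd> g) s))"
    by (simp add: G_def app_sum_op app_cscale app_op assms app_linear)
  then show "(G n \<rhd> f) s = ((\<Sum>l\<in>UNIV. \<Sum>i\<in>UNIV. (y l * p i) \<odot> X n l i) \<rhd> f0) s
    + ((\<Sum>l\<in>UNIV. \<Sum>i\<in>UNIV. (y l * q i) \<odot> X n l i) \<rhd> g) s"
    by (simp add: app_sum_op app_cscale) (simp add: sum_2 algebra_simps)
qed

lemma corner_inverse:
  assumes "n < N"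
  obtains W where "(\<Sum>l\<in>UNIV. \<Sum>i\<in>UNIV. (y l * q i) \<odot> X n l i) * W = 1"
    "W * (\<Sum>l\<in>UNIV. \<Sum>i\<in>UNIV. (y l * q i) \<odot> X n l i) = 1"
proof -
  have "\<xi> n \<noteq> \<xi> m \<and> \<xi> n \<noteq> \<xi> m - \<eta>" if "m \<in> set (rev [Suc n..<N])" for m
    using xi_gen[OF assms, of m] that by simp
  then show ?thesis
    using corner_invertible[of "rev [Suc n..<N]" "\<xi> n"] that unfolding X_def by auto
qed

lemma commutes_sub_X: "m \<le> n \<Longrightarrow> commutes (sub m i) (X n k l)"
  unfolding X_def by (intro commutes_mon commutes_sub_munit) auto

text \<open>Invariance under every \<open>sub m i\<close> means independence of spin
  \<open>m\<close>. The \<open>x\<close> component of \<open>f\<close> has to be \<open>f0\<close>,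
  and the equation for \<open>G n\<close> is then solved for the \<open>y\<close> component.\<close>

lemma step_surjective:
  assumes n: "n < N" and inv: "\<And>m i. m \<le> n \<Longrightarrow> sub m i \<rhd> f0 = f0" "\<And>m i. m \<le> n \<Longrightarrow> sub m i \<rhd> f1 = f1"
  shows "\<exists>f. (\<forall>m<n. \<forall>i. sub m i \<rhd> f = f) \<and> contr n x \<rhd> f = f0 \<and> G n \<rhd> f = f1"
proof -
  let ?B = "\<Sum>l\<in>UNIV. \<Sum>i\<in>UNIV. (y l * p i) \<odot> X n l i"
  let ?D = "\<Sum>l\<in>UNIV. \<Sum>i\<in>UNIV. (y l * q i) \<odot> X n l i"
  obtain W where W: "?D * W = 1" "W * ?D = 1" using corner_inverse[OF n] .
  have comB: "commutes (sub m i) ?B" and comD: "commutes (sub m i) ?D" if "m \<le> n" for m i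
    using that by (intro commutes_sum commutes_cscale commutes_sub_X; simp)+
  \<comment> \<open>The inverse inherits commutation, so \<open>g\<close> below stays independent of
    the spins up to \<open>n\<close>.\<close>
  have comW: "commutes (sub m i) W" if "m \<le> n" for m i
    using commutes_inverse[OF comD W] that by blast
  define g where "g = W \<rhd> (\<lambda>s. f1 s - (?B \<rhd> f0) s)"
  have B_inv: "sub m i \<rhd> ?B \<rhd> f0 = ?B \<rhd> f0" if "m \<le> n" for m i
    using commutes_appD[OF comB[OF that]] inv(1)[OF that] by simp
  have diff_inv: "sub m i \<rhd> (\<lambda>s. f1 s - (?B \<rhd> f0) s) = (\<lambda>s. f1 s - (?B \<rhd> f0) s)" if "m \<le> n" for m i
    using app_linear[of "sub m i" 1 f1 "- 1" "?B \<rhd> f0"] inv(2)[OF that] B_inv[OF that] by simp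
  have g_inv: "sub m i \<rhd> g = g" if "m \<le> n" for m i
    unfolding g_def using commutes_appD[OF comW[OF that]] diff_inv[OF that] by simp
  define f where "f = (\<lambda>s. p (s n) * f0 s + q (s n) * g s)"
  have f_sub: "sub n i \<rhd> f = (\<lambda>s. p i * f0 s + q i * g s)" for i
    using fun_cong[OF inv(1)[of n i]] fun_cong[OF g_inv[of n i]] by (simp add: f_def sub.rep_eq)
  have "sub m i \<rhd> f = f" if "m < n" for m i
    using fun_cong[OF inv(1)[of m i]] fun_cong[OF g_inv[of m i]] that by (simp add: f_def sub.rep_eq)
  moreover have "contr n x \<rhd> f = f0"
  proof -
    have "contr n x \<rhd> f = (\<lambda>s. (\<Sum>i\<in>UNIV. x i * p i) * f0 s + (\<Sum>i\<in>UNIV. x i * q i) * g s)"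
      unfolding contr_app f_sub by (simp add: sum_2 algebra_simps)
    then show ?thesis by (simp add: dual)
  qed
  moreover have "G n \<rhd> f = f1"
    unfolding G_split[OF f_sub] using W by (simp add: g_def app_app) (simp add: app_op)
  ultimately show ?thesis by blast
qed

text \<open>Without an \<open>x\<close> component \<open>f\<close> is given by its \<open>y\<close>
  component \<open>g\<close>, which the invertible corner forces to vanish.\<close>

lemma step_injective:
  assumes n: "n < N" and zero: "contr n x \<rhd> f = (\<lambda>s. 0)" "G n \<rhd> f = (\<lambda>s. 0)"
  shows "f = (\<lambda>s. 0)"
proof -
  let ?D = "\<Sum>l\<in>UNIV. \<Sum>i\<in>UNIV. (y l * q i) \<odot> X n l i"
  obtain W where W: "?D * W = 1" "W * ?D = 1" using corner_inverse[OF n] .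
  define g where "g = contr n y \<rhd> f"
  have f_sub: "sub n i \<rhd> f = (\<lambda>s. p i * 0 + q i * g s)" for i
  proof
    fix s
    have "p i * (contr n x \<rhd> f) s + q i * g s
      = (p i * x 1 + q i * y 1) * (sub n 1 \<rhd> f) s + (p i * x 2 + q i * y 2) * (sub n 2 \<rhd> f) s"
      by (simp add: g_def contr_app sum_2 algebra_simps)
    also have "\<dots> = (sub n i \<rhd> f) s"
      unfolding resolution using exhaust_2[of i] by auto
    finally show "(sub n i \<rhd> f) s = p i * 0 + q i * g s" by (simp add: zero)
  qed
  have "?D \<rhd> g = (\<lambda>s. 0)"
    using zero(2) unfolding G_split[OF f_sub] by (simp add: app_zero)
  then have "W \<rhd> ?D \<rhd> g = (\<lambda>s. 0)" by (simp add: app_zero)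
  then have "g = (\<lambda>s. 0)" using W by (simp add: app_app) (simp add: app_op)
  then have "(sub n (s n) \<rhd> f) s = 0" for s by (simp add: f_sub)
  then show ?thesis by (simp add: sub.rep_eq fun_eq_iff)
qed

text \<open>The reversed list lets the factor of site \<open>n\<close> act first on functions, in
  the same order as in \<open>P\<close>.\<close>

definition \<Lambda> :: "(nat \<Rightarrow> nat) \<Rightarrow> nat \<Rightarrow> chain_op" where
  "\<Lambda> h n = prod_list (map (\<lambda>m. if h m = 0 then contr m x else G m) (rev [n..<N]))"

definition P :: "(nat \<Rightarrow> nat) \<Rightarrow> nat \<Rightarrow> chain_op" where
  "P h n = prod_list (map (\<lambda>m. T (\<xi> m) ^ h m) (rev [n..<N]))"

lemma \<Lambda>_step: "n < N \<Longrightarrow> \<Lambda> h n = \<Lambda> h (Suc n) * (if h n = 0 then contr n x else G n)"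
  by (simp add: \<Lambda>_def upt_conv_Cons)

lemma P_step: "n < N \<Longrightarrow> P h n = P h (Suc n) * T (\<xi> n) ^ h n"
  by (simp add: P_def upt_conv_Cons)

lemma \<Lambda>_cong: "(\<And>m. n \<le> m \<Longrightarrow> m < N \<Longrightarrow> h m = h' m) \<Longrightarrow> \<Lambda> h n = \<Lambda> h' n"
  unfolding \<Lambda>_def by (intro arg_cong[of _ _ prod_list] map_cong) auto

text \<open>Downward induction on \<open>n\<close>: the two values of \<open>h n\<close> supply the
  data \<open>f0\<close> and \<open>f1\<close> of \<open>step_surjective\<close>.\<close>

lemma \<Lambda>_surjective:
  assumes "n \<le> N" "\<And>h h'. (\<And>m. n \<le> m \<Longrightarrow> m < N \<Longrightarrow> h m = h' m) \<Longrightarrow> a h = a h'"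
  shows "\<exists>f. (\<forall>m<n. \<forall>i. sub m i \<rhd> f = f) \<and> (\<forall>h. (\<forall>m. h m \<le> 1) \<longrightarrow> \<Lambda> h n \<rhd> f = (\<lambda>s. a h))"
  using assms
proof (induction arbitrary: a rule: inc_induct)
  case base
  obtain a0 where "\<And>h. a h = a0"
    using base[of "\<lambda>_. 0"] by (metis leD)
  then show ?case
    by (intro exI[of _ "\<lambda>s. a0"]) (auto simp: sub.rep_eq \<Lambda>_def app_op)
next
  case (step n)
  \<comment> \<open>\<open>F b\<close> realizes the prescribed values with \<open>h n\<close> frozen
    to \<open>b\<close>.\<close>
  have "\<exists>F. \<forall>b. (\<forall>m<Suc n. \<forall>i. sub m i \<rhd> F b = F b) \<and>
      (\<forall>h. (\<forall>m. h m \<le> 1) \<longrightarrow> \<Lambda> h (Suc n) \<rhd> F b = (\<lambda>s. a (h(n := b))))"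
    by (intro choice allI step.IH, rule step.prems) (auto simp: Suc_le_eq)
  then obtain F where F: "\<And>b m i. m \<le> n \<Longrightarrow> sub m i \<rhd> F b = F b"
      "\<And>b h. (\<forall>m. h m \<le> 1) \<Longrightarrow> \<Lambda> h (Suc n) \<rhd> F b = (\<lambda>s. a (h(n := b)))"
    unfolding less_Suc_eq_le by blast
  obtain f where f: "\<And>m i. m < n \<Longrightarrow> sub m i \<rhd> f = f" "contr n x \<rhd> f = F 0" "G n \<rhd> f = F 1"
    using step_surjective[of n "F 0" "F 1"] step.hyps F(1) by blast
  have "\<Lambda> h n \<rhd> f = (\<lambda>s. a h)" if h: "(\<forall>m. h m \<le> 1)" for h
  proof -
    have "h n = 0 \<or> h n = 1" using spec[OF h, of n] by linarith
    then have "\<Lambda> h n \<rhd> f = \<Lambda> h (Suc n) \<rhd> F (h n)"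
      using step.hyps f by (auto simp: \<Lambda>_step simp flip: app_app)
    then show ?thesis using F(2)[OF h, of "h n"] by simp
  qed
  then show ?case using f(1) by blast
qed

lemma \<Lambda>_injective:
  assumes "n \<le> N" "\<And>h. (\<forall>m. h m \<le> 1) \<Longrightarrow> \<Lambda> h n \<rhd> f = (\<lambda>s. 0)"
  shows "f = (\<lambda>s. 0)"
  using assms
proof (induction arbitrary: f rule: inc_induct)
  case base
  from base[of "\<lambda>_. 0"] show ?case by (simp add: \<Lambda>_def app_op)
next
  case (step n)
  have *: "\<Lambda> h (Suc n) \<rhd> (if b = 0 then contr n x else G n) \<rhd> f = (\<lambda>s. 0)"
    if "(\<forall>m. h m \<le> 1)" "b \<in> {0, 1}" for h and b :: nat
  proof -
    have "\<forall>m. (h(n := b)) m \<le> 1" using that by auto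
    then have "\<Lambda> (h(n := b)) n \<rhd> f = (\<lambda>s. 0)" by (rule step.prems)
    moreover have "\<Lambda> (h(n := b)) (Suc n) = \<Lambda> h (Suc n)" by (rule \<Lambda>_cong) auto
    ultimately show ?thesis using step.hyps by (simp add: \<Lambda>_step app_app)
  qed
  have "contr n x \<rhd> f = (\<lambda>s. 0)" by (rule step.IH) (use *[of _ 0] in simp)
  moreover have "G n \<rhd> f = (\<lambda>s. 0)" by (rule step.IH) (use *[of _ 1] in simp)
  ultimately show ?case by (rule step_injective[OF step.hyps(2)])
qed

text \<open>The covector is pushed through the product from the top site downwards; a factor
  \<open>T (\<xi> m)\<close> replaces \<open>contr m x\<close> by
  \<open>\<kappa> m \<odot> G m\<close>.\<close>

lemma contr_below_P:
  assumes "n \<le> N" "(\<forall>m. h m \<le> 1)"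
  shows "contr_below N * P h n = (\<Prod>m\<in>{n..<N}. \<kappa> m ^ h m) \<odot> (\<Lambda> h n * contr_below n)"
  using assms(1)
proof (induction rule: inc_induct)
  case base
  show ?case by (simp add: P_def \<Lambda>_def)
next
  case (step n)
  have prod: "(\<Prod>m\<in>{n..<N}. \<kappa> m ^ h m) = (\<Prod>m\<in>{Suc n..<N}. \<kappa> m ^ h m) * \<kappa> n ^ h n"
    using step.hyps by (simp add: prod.atLeast_Suc_lessThan mult.commute)
  have "contr_below N * P h n = (\<Prod>m\<in>{Suc n..<N}. \<kappa> m ^ h m) \<odot> (\<Lambda> h (Suc n) * (contr_below (Suc n) * T (\<xi> n) ^ h n))"
    using step by (simp add: P_step mult.assoc[symmetric] del: contr_below.simps)
  moreover consider "h n = 0" | "h n = 1" using spec[OF assms(2), of n] by linarith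
  then have "\<Lambda> h (Suc n) * (contr_below (Suc n) * T (\<xi> n) ^ h n) = \<kappa> n ^ h n \<odot> (\<Lambda> h n * contr_below n)"
  proof cases
    case 1
    then show ?thesis using step.hyps by (simp add: \<Lambda>_step mult.assoc)
  next
    case 2
    then have "\<Lambda> h (Suc n) * (contr_below (Suc n) * T (\<xi> n) ^ h n) = \<Lambda> h (Suc n) * (\<kappa> n \<odot> (G n * contr_below n))"
      using contr_below_T[of n] step.hyps by (simp del: contr_below.simps)
    then show ?thesis using 2 step.hyps by (simp add: \<Lambda>_step mult.assoc)
  qed
  ultimately show ?case
    unfolding prod by (simp only: cscale_cscale)
qed

lemma cyclic_surjective:
  "\<exists>f. \<forall>h. (\<forall>m. h m \<le> 1) \<longrightarrow> contr_below N \<rhd> P h 0 \<rhd> f = (\<lambda>s. \<Prod>m<N. c m ^ h m)"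
proof -
  \<comment> \<open>Dividing by \<open>\<kappa> m\<close> compensates the scalars in
    \<open>contr_below_P\<close>.\<close>
  have "\<exists>f. (\<forall>m<0. \<forall>i. sub m i \<rhd> f = f) \<and>
      (\<forall>h. (\<forall>m. h m \<le> 1) \<longrightarrow> \<Lambda> h 0 \<rhd> f = (\<lambda>s. \<Prod>m<N. (c m / \<kappa> m) ^ h m))"
    by (rule \<Lambda>_surjective) (auto intro!: prod.cong)
  then obtain f where f: "\<And>h. (\<forall>m. h m \<le> 1) \<Longrightarrow> \<Lambda> h 0 \<rhd> f = (\<lambda>s. \<Prod>m<N. (c m / \<kappa> m) ^ h m)"
    by blast
  have "contr_below N \<rhd> P h 0 \<rhd> f = (\<lambda>s. \<Prod>m<N. c m ^ h m)" if h: "(\<forall>m. h m \<le> 1)" for h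
  proof -
    have "contr_below N \<rhd> P h 0 \<rhd> f = (\<lambda>s. (\<Prod>m<N. \<kappa> m ^ h m) * (\<Prod>m<N. (c m / \<kappa> m) ^ h m))"
      using contr_below_P[of 0 h] h by (simp add: app_app app_cscale f atLeast0LessThan)
    then show ?thesis
      using \<kappa>_nonzero by (simp add: prod.distrib[symmetric] power_mult_distrib[symmetric])
  qed
  then show ?thesis by blast
qed

lemma cyclic_injective:
  assumes "\<And>h. (\<forall>m. h m \<le> 1) \<Longrightarrow> contr_below N \<rhd> P h 0 \<rhd> f = (\<lambda>s. 0)"
  shows "f = (\<lambda>s. 0)"
proof (rule \<Lambda>_injective[of 0])
  fix h :: "nat \<Rightarrow> nat" assume h: "(\<forall>m. h m \<le> 1)"
  have "(\<lambda>s. (\<Prod>m\<in>{0..<N}. \<kappa> m ^ h m) * (\<Lambda> h 0 \<rhd> f) s) = (\<lambda>s. 0)"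
    using contr_below_P[of 0 h] h assms[OF h] by (simp add: app_app app_cscale)
  moreover have "(\<Prod>m\<in>{0..<N}. \<kappa> m ^ h m) \<noteq> 0" using \<kappa>_nonzero by simp
  ultimately show "\<Lambda> h 0 \<rhd> f = (\<lambda>s. 0)" by (simp add: fun_eq_iff)
qed simp

end

section \<open>Eigenfunctions\<close>

lemma poly_op_prod:
  "finite B \<Longrightarrow> poly_op (card B) (\<lambda>z. (\<Prod>b\<in>B. z - y b) \<odot> 1) 1"
proof (induction B rule: finite_induct)
  case empty
  show ?case by (simp add: poly_op_const)
next
  case (insert b B)
  then show ?case using poly_op_shift[of "card B" "\<lambda>z. (\<Prod>b\<in>B. z - y b) \<odot> 1" 1 "y b"] by simp
qed

lemma poly_op_gfun:
  assumes "a < N"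
  shows "poly_op N (\<lambda>z. gfun y N a z \<odot> 1) 0"
proof -
  let ?B = "{..<N} - {a}"
  have "poly_op (Suc (card ?B)) (\<lambda>z. inverse (\<Prod>b\<in>?B. y a - y b) \<odot> (\<Prod>b\<in>?B. z - y b) \<odot> 1) 0"
    by (rule poly_op_Suc[OF poly_op_cscale[OF poly_op_prod]]) simp
  moreover have "Suc (card ?B) = N" using assms by simp
  moreover have "gfun y N a z = inverse (\<Prod>b\<in>?B. y a - y b) * (\<Prod>b\<in>?B. z - y b)" for z
    unfolding gfun_def prod_dividef by (simp only: divide_inverse mult.commute)
  ultimately show ?thesis by (simp only: cscale_cscale)
qed

lemma cscale_one_inject: "c \<odot> 1 = d \<odot> (1 :: chain_op) \<longleftrightarrow> c = d"
proof
  assume "c \<odot> 1 = d \<odot> (1 :: chain_op)"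
  then have "((c \<odot> 1) \<rhd> (\<lambda>_. 1)) undefined = ((d \<odot> 1) \<rhd> (\<lambda>_. 1)) undefined" by simp
  then show "c = d" by (simp add: app_cscale app_op)
qed simp

text \<open>Regarded as multiples of the identity, the values \<open>t z\<close> form an operator
  polynomial with leading coefficient \<tau>, which can be interpolated at any distinct
  nodes.\<close>

lemma interpolant_change_nodes:
  assumes t: "\<And>z. t z = \<tau> * dfun y N z + (\<Sum>a<N. gfun y N a z * x a)"
    and "inj_on y' {..<N}"
  shows "t z = \<tau> * dfun y' N z + (\<Sum>a<N. gfun y' N a z * t (y' a))"
proof -
  have "poly_op N (\<lambda>z. \<tau> \<odot> (dfun y N z \<odot> 1)) (\<tau> \<odot> 1)"
    using poly_op_prod[of "{..<N}" y] by (intro poly_op_cscale) (simp add: dfun_def)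
  moreover have "poly_op N (\<lambda>z. \<Sum>a<N. x a \<odot> (gfun y N a z \<odot> 1)) (\<Sum>a<N. x a \<odot> 0)"
    by (intro poly_op_sum poly_op_cscale poly_op_gfun) auto
  ultimately have "poly_op N (\<lambda>z. \<tau> \<odot> (dfun y N z \<odot> 1) + (\<Sum>a<N. x a \<odot> (gfun y N a z \<odot> 1)))
      (\<tau> \<odot> 1 + (\<Sum>a<N. x a \<odot> 0))"
    by (rule poly_op_add)
  moreover have "\<tau> \<odot> (dfun y N z \<odot> 1) + (\<Sum>a<N. x a \<odot> (gfun y N a z \<odot> 1)) = t z \<odot> 1" for z
    by (simp add: t cscale_add_left cscale_sum_left mult.commute)
  ultimately have "poly_op N (\<lambda>z. t z \<odot> 1) (\<tau> \<odot> 1)" by simp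
  from poly_op_interpolation[OF this assms(2), of z]
  have "t z \<odot> 1 = (\<tau> * dfun y' N z + (\<Sum>a<N. gfun y' N a z * t (y' a))) \<odot> 1"
    by (simp add: cscale_add_left cscale_sum_left mult.commute)
  then show ?thesis by (simp only: cscale_one_inject)
qed

section \<open>Eigenvectors of the finite chain as functions on the infinite chain\<close>

definition extend :: "nat \<Rightarrow> wave \<Rightarrow> wave" where
  "extend N v = (\<lambda>s. v (restrict s {..<N}))"

lemma restrict_states [simp]: "restrict s {..<N} \<in> states N"
  by (simp add: states_def)

lemma restrict_overlay: "s' \<in> states N \<Longrightarrow> restrict (overlay N s' s) {..<N} = s'"
  by (auto simp: states_def overlay_def fun_eq_iff restrict_def PiE_def extensional_def)

lemma overlay_states: "s' \<in> states N \<Longrightarrow> s \<in> states N \<Longrightarrow> overlay N s' s = s'"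
  by (auto simp: states_def overlay_def fun_eq_iff PiE_def extensional_def)

lemma extend_states: "s \<in> states N \<Longrightarrow> extend N v s = v s"
  by (simp add: extend_def states_def PiE_restrict)

lemma transfer_restrict: "transfer \<eta> \<xi> K N z (restrict s {..<N}) s' = transfer \<eta> \<xi> K N z s s'"
  unfolding transfer_def by (intro sum.cong refl arg_cong2[of _ _ _ _ "(*)"] prod.cong) auto

context spin_chain
begin

definition eigenfunction :: "(complex \<Rightarrow> complex) \<Rightarrow> wave \<Rightarrow> bool" where
  "eigenfunction t f \<longleftrightarrow> (\<forall>z. T z \<rhd> f = (\<lambda>s. t z * f s))"

lemma eigvec_extend:
  assumes "is_eigvec \<eta> \<xi> K N t v"
  shows "eigenfunction t (extend N v)"
  unfolding eigenfunction_def
proof (intro allI ext)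
  fix z s
  have "(T z \<rhd> extend N v) s = (\<Sum>s'\<in>states N. transfer \<eta> \<xi> K N z (restrict s {..<N}) s' * v s')"
    unfolding app_transfer_op transfer_restrict by (intro sum.cong refl) (simp add: extend_def restrict_overlay)
  also have "\<dots> = t z * extend N v s"
    using assms by (simp add: is_eigvec_def extend_def)
  finally show "(T z \<rhd> extend N v) s = t z * extend N v s" .
qed

text \<open>On \<open>states N\<close> all spectator spins are \<open>undefined\<close>, so
  restriction there yields an eigenvector even when \<open>f\<close> depends on spectators.\<close>

lemma eigenfunction_eigvec:
  assumes "eigenfunction t f" "s \<in> states N" "f s \<noteq> 0"
  shows "is_eigvec \<eta> \<xi> K N t f"
  unfolding is_eigvec_def
proof (intro conjI allI ballI)
  show "\<exists>s\<in>states N. f s \<noteq> 0" using assms by blast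
  fix z s assume s: "s \<in> states N"
  have "(T z \<rhd> f) s = (\<Sum>s'\<in>states N. transfer \<eta> \<xi> K N z s s' * f s')"
    unfolding app_transfer_op using s by (intro sum.cong refl) (simp add: overlay_states)
  then show "(\<Sum>s'\<in>states N. transfer \<eta> \<xi> K N z s s' * f s') = t z * f s"
    using assms(1) by (simp add: eigenfunction_def)
qed

lemma xi_inj: "inj_on \<xi> {..<N}"
  using shifted_nodes_inj[of "\<lambda>_. 0"] by simp

lemma eigenvalue_interpolation:
  assumes "eigenfunction t f" "f s \<noteq> 0"
  shows "t z = trace K * dfun \<xi> N z + (\<Sum>a<N. gfun \<xi> N a z * t (\<xi> a))"
proof -
  have "(T z \<rhd> f) s = (trace K * dfun \<xi> N z + (\<Sum>a<N. gfun \<xi> N a z * t (\<xi> a))) * f s"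
    using assms(1) unfolding T_interpolation[OF xi_inj, of z] eigenfunction_def
    by (simp add: app_op app_cscale app_sum_op distrib_right sum_distrib_right mult.assoc)
  then show ?thesis using assms by (simp add: eigenfunction_def)
qed

lemma eigenvalue_fusion:
  assumes "eigenfunction t f" "f s \<noteq> 0" "n < N"
  shows "t (\<xi> n) * t (\<xi> n - \<eta>) = afun \<eta> \<xi> N (\<xi> n) * dfun \<xi> N (\<xi> n - \<eta>) * det K"
proof -
  have "((T (\<xi> n) * T (\<xi> n - \<eta>)) \<rhd> f) s = t (\<xi> n) * t (\<xi> n - \<eta>) * f s"
    using assms(1) by (simp add: eigenfunction_def app_op app_scale)
  then show ?thesis using assms(2) by (simp add: T_fusion[OF assms(3)] app_cscale app_op)
qed

text \<open>Each transfer matrix in the covector can be moved onto \<open>v\<close>, where it acts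
  as a scalar.\<close>

lemma pairing_covec:
  assumes "is_eigvec \<eta> \<xi> K N t v"
  shows "pairing N (covec \<eta> \<xi> K N S h) v
    = (\<Prod>n<N. (t (\<xi> n) / afun \<eta> \<xi> N (\<xi> n)) ^ h n) * pairing N S v"
proof -
  let ?step = "\<lambda>m u. covact N u (\<lambda>s s'. transfer \<eta> \<xi> K N (\<xi> m) s s' / afun \<eta> \<xi> N (\<xi> m))"
  have step: "pairing N (?step m u) v = t (\<xi> m) / afun \<eta> \<xi> N (\<xi> m) * pairing N u v" for m u
  proof -
    have "pairing N (?step m u) v
      = (\<Sum>s\<in>states N. \<Sum>s'\<in>states N. u s * (transfer \<eta> \<xi> K N (\<xi> m) s s' / afun \<eta> \<xi> N (\<xi> m)) * v s')"
      unfolding pairing_def covact_def sum_distrib_right by (rule sum.swap)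
    also have "\<dots> = (\<Sum>s\<in>states N. u s / afun \<eta> \<xi> N (\<xi> m) * (\<Sum>s'\<in>states N. transfer \<eta> \<xi> K N (\<xi> m) s s' * v s'))"
      by (simp add: sum_distrib_left mult_ac)
    also have "\<dots> = (\<Sum>s\<in>states N. u s / afun \<eta> \<xi> N (\<xi> m) * (t (\<xi> m) * v s))"
      using assms by (intro sum.cong refl) (simp add: is_eigvec_def)
    finally show ?thesis by (simp add: pairing_def sum_distrib_left sum_divide_distrib mult_ac)
  qed
  have pow: "pairing N ((?step m ^^ k) u) v = (t (\<xi> m) / afun \<eta> \<xi> N (\<xi> m)) ^ k * pairing N u v" for m k u
    by (induction k) (simp_all add: step mult.assoc del: times_divide_eq_left)
  have "pairing N (covec_aux \<eta> \<xi> K N S h m) v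
    = (\<Prod>n<m. (t (\<xi> n) / afun \<eta> \<xi> N (\<xi> n)) ^ h n) * pairing N S v" for m
    by (induction m) (simp_all add: pow mult_ac)
  then show ?thesis by (simp add: covec_def)
qed

text \<open>The indicator of \<open>s\<close> is a combination of the basis covectors, and its
  pairing with \<open>v\<close> is \<open>v s\<close>.\<close>

lemma covector_basis_separates:
  assumes "covector_basis N F I" "\<And>h. h \<in> I \<Longrightarrow> pairing N (F h) v = 0" "s \<in> states N"
  shows "v s = 0"
proof -
  have "\<forall>w. \<exists>c. \<forall>s'\<in>states N. w s' = (\<Sum>h\<in>I. c h * F h s')"
    using assms(1) unfolding covector_basis_def by (rule conjunct2)
  from spec[OF this, of "\<lambda>s'. if s' = s then 1 else 0"]
  obtain c where c: "\<And>s'. s' \<in> states N \<Longrightarrow> (if s' = s then 1 else 0) = (\<Sum>h\<in>I. c h * F h s')"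
    by blast
  have fin: "finite (states N)" by (simp add: states_def finite_PiE)
  have "v s = (\<Sum>s'\<in>states N. (if s' = s then 1 else 0) * v s')"
    using assms(3) fin by (simp add: if_distrib[of "\<lambda>x. x * _"] cong: if_cong)
  also have "\<dots> = (\<Sum>s'\<in>states N. \<Sum>h\<in>I. c h * F h s' * v s')"
    by (intro sum.cong refl) (simp add: c sum_distrib_right)
  also have "\<dots> = (\<Sum>h\<in>I. c h * pairing N (F h) v)"
    unfolding pairing_def sum_distrib_left by (subst sum.swap) (simp add: mult.assoc)
  finally show ?thesis using assms(2) by simp
qed

end

section \<open>Eigenvectors through the cyclic covector\<close>

context cyclic_chain
begin

lemma contr_below_zero_states:
  assumes "\<And>s. s \<in> states N \<Longrightarrow> f s = 0"
  shows "n \<le> N \<Longrightarrow> s \<in> states N \<Longrightarrow> (contr_below n \<rhd> f) s = 0"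
proof (induction n arbitrary: s)
  case 0
  then show ?case using assms by (simp add: app_op)
next
  case (Suc n)
  have "s(n := i) \<in> states N" for i
    using Suc.prems by (auto simp: states_def PiE_def extensional_def)
  then show ?case using Suc by (simp add: app_op contr_app sub.rep_eq)
qed

text \<open>Contraction removes the dependence on the sites below \<open>n\<close>, and
  \<open>extend\<close> that on the spectators; at \<open>n = N\<close> a constant remains.\<close>

lemma contr_below_extend_cong:
  assumes "\<And>m. n \<le> m \<Longrightarrow> m < N \<Longrightarrow> s m = s' m"
  shows "(contr_below n \<rhd> extend N v) s = (contr_below n \<rhd> extend N v) s'"
  using assms
proof (induction n arbitrary: s s')
  case 0
  then have "restrict s {..<N} = restrict s' {..<N}" by (intro restrict_ext) simp
  then show ?case by (simp add: extend_def app_op)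
next
  case (Suc n)
  have "(contr_below n \<rhd> extend N v) (s(n := i)) = (contr_below n \<rhd> extend N v) (s'(n := i))" for i
    by (rule Suc.IH) (use Suc.prems in \<open>auto simp: Suc_le_eq\<close>)
  then show ?case by (simp add: app_op contr_app sub.rep_eq)
qed

lemma P_eigenfunction:
  assumes "eigenfunction t f" "n \<le> N"
  shows "P h n \<rhd> f = (\<lambda>s. (\<Prod>m\<in>{n..<N}. t (\<xi> m) ^ h m) * f s)"
  using assms(2)
proof (induction rule: inc_induct)
  case base
  show ?case by (simp add: P_def app_op)
next
  case (step n)
  have pow: "(T z ^ k) \<rhd> f = (\<lambda>s. t z ^ k * f s)" for z k
    using assms(1) by (induction k) (simp_all add: app_op eigenfunction_def app_scale mult.assoc mult.left_commute)
  show ?case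
    using step by (simp add: P_step app_op pow app_scale prod.atLeast_Suc_lessThan mult.assoc)
qed

text \<open>On an eigenfunction every covector of the cyclic family is a multiple of the cyclic
  covector itself, and the family separates functions.\<close>

lemma eigenfunction_zero:
  assumes "eigenfunction t f" "contr_below N \<rhd> f = (\<lambda>s. 0)"
  shows "f = (\<lambda>s. 0)"
  by (rule cyclic_injective) (simp add: P_eigenfunction[OF assms(1)] assms(2) app_scale)

lemma w_simple: "w_simple \<eta> \<xi> K N"
  unfolding w_simple_def
proof (intro ballI allI impI)
  fix t v w assume v: "is_eigvec \<eta> \<xi> K N t v" and w: "is_eigvec \<eta> \<xi> K N t w"
  \<comment> \<open>The pairing with the cyclic covector is a constant function;
    \<open>undefined\<close> is an arbitrary point at which to read it off.\<close>
  define a where "a u = (contr_below N \<rhd> extend N u) undefined" for u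
  have contr_below: "contr_below N \<rhd> extend N u = (\<lambda>s. a u)" for u
    unfolding a_def by (rule ext, rule contr_below_extend_cong) simp
  \<comment> \<open>The weights make the cyclic covector vanish on \<open>g\<close>.\<close>
  define g where "g = (\<lambda>s. a v * extend N w s + (- a w) * extend N v s)"
  have "eigenfunction t g"
    using eigvec_extend[OF v] eigvec_extend[OF w]
    unfolding eigenfunction_def g_def app_linear by (simp add: algebra_simps)
  moreover have "contr_below N \<rhd> g = (\<lambda>s. 0)"
    unfolding g_def app_linear contr_below by simp
  ultimately have g: "g = (\<lambda>s. 0)" by (rule eigenfunction_zero)
  have "a v \<noteq> 0"
  proof
    assume "a v = 0"
    then have "extend N v = (\<lambda>s. 0)"
      by (intro eigenfunction_zero[OF eigvec_extend[OF v]]) (simp add: contr_below)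
    then show False
      using v extend_states[of _ N v] by (auto simp: is_eigvec_def)
  qed
  moreover have "a v * w s = a w * v s" if "s \<in> states N" for s
    using fun_cong[OF g, of s] that by (simp add: g_def extend_states)
  ultimately show "\<exists>c. \<forall>s\<in>states N. w s = c * v s"
    by (intro exI[of _ "a w / a v"]) (simp add: field_simps)
qed

lemma P_upd:
  assumes "a < N"
  shows "P (h(a := 1)) 0 = P (h(a := 0)) 0 * T (\<xi> a)"
proof -
  define h1 where "h1 = h(a := 1)"
  define h0 where "h0 = h(a := 0)"
  have h: "h1 a = 1" "h0 a = 0" "\<And>m. m \<noteq> a \<Longrightarrow> h1 m = h0 m"
    by (auto simp: h1_def h0_def)
  \<comment> \<open>For \<open>n > a\<close> the factor of site \<open>a\<close> is absent. It
    enters at \<open>n = a\<close> and is afterwards moved to the right by commutativity.\<close>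
  have "P h1 n = (if n \<le> a then P h0 n * T (\<xi> a) else P h0 n)" if "n \<le> N" for n
    using that
  proof (induction rule: inc_induct)
    case base
    then show ?case using assms by (simp add: P_def)
  next
    case (step n)
    have com: "T (\<xi> a) * T (\<xi> n) ^ k = T (\<xi> n) ^ k * T (\<xi> a)" for k
      using T_commutes[OF assms step.hyps(2)]
      by (simp add: commutes_def power_commuting_commutes)
    consider "n = a" | "n < a" | "a < n" by linarith
    then show ?case
    proof cases
      case 1
      then show ?thesis using step h by (simp add: P_step)
    next
      case 2
      then show ?thesis using step h(3)[of n] by (simp add: P_step mult.assoc com)
    next
      case 3
      then show ?thesis using step h(3)[of n] by (simp add: P_step)
    qed
  qed
  from this[of 0] show ?thesis by (simp add: h1_def h0_def)
qed

lemma eigenfunction_exists: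
  fixes c :: "nat \<Rightarrow> complex"
  defines "t \<equiv> \<lambda>z. trace K * dfun \<xi> N z + (\<Sum>a<N. gfun \<xi> N a z * c a)"
  assumes sys: "\<And>n. n < N \<Longrightarrow> c n * t (\<xi> n - \<eta>) = afun \<eta> \<xi> N (\<xi> n) * dfun \<xi> N (\<xi> n - \<eta>) * det K"
  shows "\<exists>f. is_eigvec \<eta> \<xi> K N t f"
proof -
  \<comment> \<open>These product components are forced on an eigenvector with values
    \<open>c m\<close> at \<open>\<xi> m\<close> and pairing 1 with the cyclic covector.\<close>
  obtain f where f: "\<And>h. (\<forall>m. h m \<le> 1) \<Longrightarrow> contr_below N \<rhd> P h 0 \<rhd> f = (\<lambda>s. \<Prod>m<N. c m ^ h m)"
    using cyclic_surjective[of c] by blast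
  have t: "t z = trace K * dfun \<xi> N z + (\<Sum>a<N. gfun \<xi> N a z * c a)" for z
    by (simp add: t_def)
  have t_node: "t (\<xi> a) = c a" if "a < N" for a
  proof -
    have "(\<Sum>b<N. gfun \<xi> N b (\<xi> a) * c b) = (\<Sum>b<N. if b = a then c a else 0)"
      using that by (intro sum.cong) (auto simp: gfun_node[OF xi_inj])
    then show ?thesis using that by (simp add: t_def dfun_node)
  qed
  have prod_upd: "(\<Prod>m<N. c m ^ (h(a := 1)) m) = c a * (\<Prod>m<N. c m ^ (h(a := 0)) m)" if "a < N" for a h
    using that by (simp add: prod.remove[of "{..<N}" a])
  have "T z \<rhd> f = (\<lambda>s. t z * f s)" for z
  proof -
    define g where "g = (\<lambda>s. 1 * (T z \<rhd> f) s + (- t z) * f s)"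
    have "g = (\<lambda>s. 0)"
    proof (rule cyclic_injective)
      fix h :: "nat \<Rightarrow> nat" assume h: "\<forall>m. h m \<le> 1"
      let ?F = "\<Prod>m<N. c m ^ h m"
      \<comment> \<open>At these nodes the covector family is preserved up to scalars: if
        \<open>h a = 0\<close>, the operator at \<open>\<xi> a\<close> raises it to 1; if
        \<open>h a = 1\<close>, fusion at \<open>\<xi> a - \<eta>\<close> lowers it to 0.\<close>
      define u where "u a = \<xi> a - of_nat (h a) * \<eta>" for a
      have h01: "h a = 0 \<or> h a = 1" for a using spec[OF h, of a] by linarith
      have inj: "inj_on u {..<N}" unfolding u_def using h01 by (intro shifted_nodes_inj) auto
      have node: "contr_below N \<rhd> P h 0 \<rhd> T (u a) \<rhd> f = (\<lambda>s. t (u a) * ?F)" if a: "a < N" for a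
      proof (cases "h a = 0")
        case True
        then have h0: "h(a := 0) = h" by auto
        have "contr_below N \<rhd> P h 0 \<rhd> T (\<xi> a) \<rhd> f = contr_below N \<rhd> P (h(a := 1)) 0 \<rhd> f"
          using P_upd[OF a, of h] by (simp add: h0 app_op)
        also have "\<dots> = (\<lambda>s. \<Prod>m<N. c m ^ (h(a := 1)) m)"
          using h by (intro f) auto
        finally show ?thesis
          unfolding prod_upd[OF a] h0 using True a by (simp add: u_def t_node)
      next
        case False
        then have h1: "h(a := 1) = h" using h01[of a] by auto
        let ?q = "afun \<eta> \<xi> N (\<xi> a) * dfun \<xi> N (\<xi> a - \<eta>) * det K"
        have ua: "u a = \<xi> a - \<eta>" using False h01[of a] by (simp add: u_def)
        have "P h 0 * T (u a) = P (h(a := 0)) 0 * (T (\<xi> a) * T (\<xi> a - \<eta>))"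
          using P_upd[OF a, of h] unfolding h1 ua by (simp add: mult.assoc)
        then have "P h 0 * T (u a) = ?q \<odot> P (h(a := 0)) 0"
          by (simp add: T_fusion[OF a])
        then have "contr_below N \<rhd> P h 0 \<rhd> T (u a) \<rhd> f = contr_below N \<rhd> (\<lambda>s. ?q * (P (h(a := 0)) 0 \<rhd> f) s)"
          by (metis app_app app_cscale)
        also have "\<dots> = (\<lambda>s. ?q * (\<Prod>m<N. c m ^ (h(a := 0)) m))"
          unfolding app_scale using h f[of "h(a := 0)"] by simp
        \<comment> \<open>The system replaces the fusion scalar by
          \<open>c a * t (\<xi> a - \<eta>)\<close>, and its factor \<open>c a\<close> restores the
          full product.\<close>
        also have "\<dots> = (\<lambda>s. t (u a) * ?F)"
          using prod_upd[OF a, of h] unfolding h1 sys[OF a, symmetric] ua by (simp add: mult_ac)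
        finally show ?thesis .
      qed
      have "contr_below N \<rhd> P h 0 \<rhd> T z \<rhd> f = (\<lambda>s. (trace K * dfun u N z) * ?F + (\<Sum>a<N. gfun u N a z * (t (u a) * ?F)))"
      proof -
        have "(contr_below N * P h 0) * T z = (trace K * dfun u N z) \<odot> (contr_below N * P h 0)
            + (\<Sum>a<N. gfun u N a z \<odot> (contr_below N * P h 0 * T (u a)))"
          unfolding T_interpolation[OF inj, of z] by (simp add: distrib_left sum_distrib_left)
        then have "((contr_below N * P h 0) * T z) \<rhd> f = (\<lambda>s. (trace K * dfun u N z) * (contr_below N \<rhd> P h 0 \<rhd> f) s
            + (\<Sum>a<N. gfun u N a z * (contr_below N \<rhd> P h 0 \<rhd> T (u a) \<rhd> f) s))"
          by (simp add: fun_eq_iff app_op app_cscale app_sum_op)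
        then show ?thesis by (simp add: app_op f[OF h] node)
      qed
      also have "\<dots> = (\<lambda>s. t z * ?F)"
        unfolding interpolant_change_nodes[OF t inj, of z]
        by (simp add: distrib_right sum_distrib_right mult.assoc)
      finally show "contr_below N \<rhd> P h 0 \<rhd> g = (\<lambda>s. 0)"
        unfolding g_def app_linear by (simp add: f[OF h])
    qed
    then show ?thesis by (simp add: g_def fun_eq_iff)
  qed
  then have ef: "eigenfunction t f" by (simp add: eigenfunction_def)
  \<comment> \<open>The component at \<open>h = 0\<close> is 1, which excludes that \<open>f\<close>
    vanishes on all of \<open>states N\<close>.\<close>
  have "contr_below N \<rhd> f = (\<lambda>s. 1)"
    using f[of "\<lambda>_. 0"] by (simp add: P_def map_replicate_const app_op)
  then have "\<exists>s\<in>states N. f s \<noteq> 0"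
    using contr_below_zero_states[of f N "restrict undefined {..<N}"] restrict_states by fastforce
  then show ?thesis using eigenfunction_eigvec[OF ef] by blast
qed

end

text \<open>If \<open>x\<close> and \<open>x K\<close> were always dependent, their determinant, a
  quadratic form in \<open>x\<close>, would vanish; its values at \<open>(1, 0)\<close>,
  \<open>(0, 1)\<close> and \<open>(1, 1)\<close> then make \<open>K\<close> scalar.\<close>

lemma nonscalar_frame:
  fixes K :: "complex^2^2"
  assumes "\<forall>\<alpha>. K \<noteq> mat \<alpha>"
  obtains x y p q :: "2 \<Rightarrow> complex" where
    "\<And>l. y l = (\<Sum>c\<in>UNIV. x c * K $ c $ l)"
    "(\<Sum>i\<in>UNIV. x i * p i) = 1" "(\<Sum>i\<in>UNIV. x i * q i) = 0"
    "(\<Sum>i\<in>UNIV. y i * p i) = 0" "(\<Sum>i\<in>UNIV. y i * q i) = 1"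
    "\<And>i j. p i * x j + q i * y j = (if i = j then 1 else 0)"
proof -
  have "\<exists>x :: 2 \<Rightarrow> complex. x 1 * (x 1 * K $ 1 $ 2 + x 2 * K $ 2 $ 2) - x 2 * (x 1 * K $ 1 $ 1 + x 2 * K $ 2 $ 1) \<noteq> 0"
  proof (rule ccontr)
    assume "\<not> ?thesis"
    then have *: "x 1 * (x 1 * K $ 1 $ 2 + x 2 * K $ 2 $ 2) - x 2 * (x 1 * K $ 1 $ 1 + x 2 * K $ 2 $ 1) = 0"
      for x :: "2 \<Rightarrow> complex"
      by blast
    have "K $ 1 $ 2 = 0" using *[of "\<lambda>i. if i = 1 then 1 else 0"] by simp
    moreover have "K $ 2 $ 1 = 0" using *[of "\<lambda>i. if i = 2 then 1 else 0"] by simp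
    moreover have "K $ 1 $ 1 = K $ 2 $ 2" using *[of "\<lambda>i. 1"] calculation by simp
    ultimately have "K = mat (K $ 1 $ 1)" by (simp add: vec_eq_iff mat_def forall_2)
    then show False using assms by blast
  qed
  then obtain x :: "2 \<Rightarrow> complex" where x: "x 1 * (x 1 * K $ 1 $ 2 + x 2 * K $ 2 $ 2) - x 2 * (x 1 * K $ 1 $ 1 + x 2 * K $ 2 $ 1) \<noteq> 0"
    by blast
  define y where "y l = (\<Sum>c\<in>UNIV. x c * K $ c $ l)" for l
  define \<Delta> where "\<Delta> = x 1 * y 2 - x 2 * y 1"
  have \<Delta>: "\<Delta> \<noteq> 0" using x by (simp add: \<Delta>_def y_def sum_2)
  \<comment> \<open>The columns of the inverse of the matrix with rows \<open>x, y\<close>, by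
    Cramer's rule.\<close>
  define p where "p i = (if i = 1 then y 2 else - y 1) / \<Delta>" for i :: 2
  define q where "q i = (if i = 1 then - x 2 else x 1) / \<Delta>" for i :: 2
  show ?thesis
  proof (rule that[of y x p q])
    show "(\<Sum>i\<in>UNIV. x i * p i) = 1" "(\<Sum>i\<in>UNIV. x i * q i) = 0"
      "(\<Sum>i\<in>UNIV. y i * p i) = 0" "(\<Sum>i\<in>UNIV. y i * q i) = 1"
      using \<Delta> by (simp_all add: sum_2 p_def q_def field_simps) (simp_all add: \<Delta>_def algebra_simps)
    show "p i * x j + q i * y j = (if i = j then 1 else 0)" for i j
      using \<Delta> exhaust_2[of i] exhaust_2[of j]
      by (auto simp: p_def q_def field_simps) (simp_all add: \<Delta>_def algebra_simps)
  qed (simp add: y_def)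
qed

section \<open>Spectrum, simplicity and components of the eigenvectors\<close>

theorem theorem3p1:
  fixes \<eta> :: complex and N :: nat and K :: "complex^2^2" and \<xi> :: "nat \<Rightarrow> complex"
  assumes N_pos: "N \<ge> 1"
    and eta_nz: "\<eta> \<noteq> 0"
    and K_nonscalar: "\<forall>\<alpha>::complex. K \<noteq> mat \<alpha>"
    and xi_gen: "\<forall>a<N. \<forall>b<N. a \<noteq> b \<longrightarrow> (\<forall>r\<in>{-1, 0, 1::int}. \<xi> a \<noteq> \<xi> b + of_int r * \<eta>)"
  shows "eigenvalues \<eta> \<xi> K N =
           { (\<lambda>z. trace K * (\<Prod>a<N. z - \<xi> a) + (\<Sum>a<N. gfun \<xi> N a z * x a)) | x.
               \<forall>n<N. x n * (trace K * (\<Prod>a<N. \<xi> n - \<xi> a - \<eta>)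
                              + (\<Sum>a<N. gfun \<xi> N a (\<xi> n - \<eta>) * x a))
                     = afun \<eta> \<xi> N (\<xi> n) * dfun \<xi> N (\<xi> n - \<eta>) * det K }
         \<and> w_simple \<eta> \<xi> K N
         \<and> (\<forall>S. covector_basis N (covec \<eta> \<xi> K N S) (hset N) \<longrightarrow>
              (\<forall>t\<in>eigenvalues \<eta> \<xi> K N.
                 (\<exists>v. is_eigvec \<eta> \<xi> K N t v \<and> pairing N S v = 1) \<and>
                 (\<forall>v. is_eigvec \<eta> \<xi> K N t v \<and> pairing N S v = 1 \<longrightarrow>
                    (\<forall>h\<in>hset N. pairing N (covec \<eta> \<xi> K N S h) v
                                 = (\<Prod>n<N. (t (\<xi> n) / afun \<eta> \<xi> N (\<xi> n)) ^ h n)))))"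
proof -
  obtain x y p q :: "2 \<Rightarrow> complex" where frame:
    "\<And>l. y l = (\<Sum>c\<in>UNIV. x c * K $ c $ l)"
    "(\<Sum>i\<in>UNIV. x i * p i) = 1" "(\<Sum>i\<in>UNIV. x i * q i) = 0"
    "(\<Sum>i\<in>UNIV. y i * p i) = 0" "(\<Sum>i\<in>UNIV. y i * q i) = 1"
    "\<And>i j. p i * x j + q i * y j = (if i = j then 1 else 0)"
    by (rule nonscalar_frame[OF K_nonscalar]) (rule that)
  interpret cyclic_chain \<eta> \<xi> x y p q K N
  proof
    show "\<xi> a \<noteq> \<xi> b \<and> \<xi> a \<noteq> \<xi> b + \<eta> \<and> \<xi> a \<noteq> \<xi> b - \<eta>" if "a < N" "b < N" "a \<noteq> b" for a b
    proof -
      have "\<forall>r\<in>{-1, 0, 1::int}. \<xi> a \<noteq> \<xi> b + of_int r * \<eta>" using xi_gen that by blast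
      then show ?thesis by simp
    qed
  qed (fact frame eta_nz)+
  have shift: "(\<Prod>a<N. \<xi> n - \<xi> a - \<eta>) = dfun \<xi> N (\<xi> n - \<eta>)" for n
    by (simp add: dfun_def algebra_simps)
  have "eigenvalues \<eta> \<xi> K N =
     { (\<lambda>z. trace K * dfun \<xi> N z + (\<Sum>a<N. gfun \<xi> N a z * x a)) | x.
       \<forall>n<N. x n * (trace K * dfun \<xi> N (\<xi> n - \<eta>) + (\<Sum>a<N. gfun \<xi> N a (\<xi> n - \<eta>) * x a))
         = afun \<eta> \<xi> N (\<xi> n) * dfun \<xi> N (\<xi> n - \<eta>) * det K }" (is "_ = ?R")
  proof (intro equalityI subsetI)
    fix t assume "t \<in> eigenvalues \<eta> \<xi> K N"
    then obtain v where v: "is_eigvec \<eta> \<xi> K N t v" by (auto simp: eigenvalues_def)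
    then obtain s where s: "s \<in> states N" "v s \<noteq> 0" by (auto simp: is_eigvec_def)
    then have nz: "extend N v s \<noteq> 0" by (simp add: extend_states)
    note t = eigenvalue_interpolation[OF eigvec_extend[OF v] nz]
    \<comment> \<open>The solution of the system attached to \<open>t\<close> consists of its values
      at the \<open>\<xi> a\<close>.\<close>
    have "t = (\<lambda>z. trace K * dfun \<xi> N z + (\<Sum>a<N. gfun \<xi> N a z * t (\<xi> a)))"
      by (rule ext) (rule t)
    moreover have "t (\<xi> n) * (trace K * dfun \<xi> N (\<xi> n - \<eta>) + (\<Sum>a<N. gfun \<xi> N a (\<xi> n - \<eta>) * t (\<xi> a)))
         = afun \<eta> \<xi> N (\<xi> n) * dfun \<xi> N (\<xi> n - \<eta>) * det K" if "n < N" for n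
      using eigenvalue_fusion[OF eigvec_extend[OF v] nz that] unfolding t[of "\<xi> n - \<eta>"] .
    ultimately show "t \<in> ?R" by (intro CollectI exI[of _ "\<lambda>a. t (\<xi> a)"] conjI) auto
  next
    fix t assume "t \<in> ?R"
    then obtain c where "t = (\<lambda>z. trace K * dfun \<xi> N z + (\<Sum>a<N. gfun \<xi> N a z * c a))"
      "\<And>n. n < N \<Longrightarrow> c n * (trace K * dfun \<xi> N (\<xi> n - \<eta>) + (\<Sum>a<N. gfun \<xi> N a (\<xi> n - \<eta>) * c a))
         = afun \<eta> \<xi> N (\<xi> n) * dfun \<xi> N (\<xi> n - \<eta>) * det K"
      by blast
    then show "t \<in> eigenvalues \<eta> \<xi> K N"
      unfolding eigenvalues_def using eigenfunction_exists[of c] by simp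
  qed
  moreover have "(\<exists>v. is_eigvec \<eta> \<xi> K N t v \<and> pairing N S v = 1) \<and>
      (\<forall>v. is_eigvec \<eta> \<xi> K N t v \<and> pairing N S v = 1 \<longrightarrow>
        (\<forall>h\<in>hset N. pairing N (covec \<eta> \<xi> K N S h) v = (\<Prod>n<N. (t (\<xi> n) / afun \<eta> \<xi> N (\<xi> n)) ^ h n)))"
    if S: "covector_basis N (covec \<eta> \<xi> K N S) (hset N)" and t: "t \<in> eigenvalues \<eta> \<xi> K N" for S t
  proof (intro conjI allI impI ballI)
    obtain v where v: "is_eigvec \<eta> \<xi> K N t v" using t by (auto simp: eigenvalues_def)
    \<comment> \<open>All components of \<open>v\<close> in the covector basis are multiples of this
      pairing, so its vanishing would force \<open>v = 0\<close>.\<close>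
    have "pairing N S v \<noteq> 0"
    proof
      assume "pairing N S v = 0"
      then have "v s = 0" if "s \<in> states N" for s
        using covector_basis_separates[OF S _ that] pairing_covec[OF v] by simp
      then show False using v by (auto simp: is_eigvec_def)
    qed
    then show "\<exists>v. is_eigvec \<eta> \<xi> K N t v \<and> pairing N S v = 1"
      using v
      by (intro exI[of _ "\<lambda>s. v s / pairing N S v"])
        (auto simp: is_eigvec_def pairing_def simp flip: sum_divide_distrib)
  next
    fix v h assume "is_eigvec \<eta> \<xi> K N t v \<and> pairing N S v = 1"
    then show "pairing N (covec \<eta> \<xi> K N S h) v = (\<Prod>n<N. (t (\<xi> n) / afun \<eta> \<xi> N (\<xi> n)) ^ h n)"
      using pairing_covec[of t v S h] by simp
  qed
  ultimately show ?thesis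
    using w_simple unfolding shift by (simp add: dfun_def)
qed

end
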